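(* Let $H_i$, $i\ge1$, be a descending chain of subgroups of finite index in $\mathcal{L}_n$ with trivial core. Then $RG(\mathcal{L}_n,\{H_i\})=0$. If $n=1$, the converse is also true: if $\{H_i\}$ is a descending chain of subgroups of finite index in $\mathcal{L}_1$ with $RG(\mathcal{L}_1,\{H_i\})=0$, then the chain has trivial core.
   Context: $p$ is a fixed prime, $n\ge 1$. $\mathcal{L}_n=(\mathbb{Z}/p\mathbb{Z})^n\wr\mathbb{Z}=\left(\bigoplus_{\mathbb{Z}}(\mathbb{Z}/p\mathbb{Z})^n\right)\rtimes\mathbb{Z}$, where the generator of $\mathbb{Z}$ acts by the shift by one. For a group $G$ and a descending sequence $\{H_i\}_{i\ge1}$ of subgroups of finite index, the rank gradient is $RG(G,\{H_i\})=\lim_{i\to\infty}\frac{d(H_i)-1}{[G:H_i]}$, where $d(H)$ is the minimal number of generators of $H$. The chain has trivial core if $\bigcap_iH_i$ contains no nontrivial normal subgroup of $G$. *)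

theory Defs
  imports "HOL-Algebra.Algebra" "HOL-Library.Extended_Real" "HOL-Computational_Algebra.Primes"
begin

definition semidirect_product ::
  "('a, 'c) monoid_scheme \<Rightarrow> ('b, 'd) monoid_scheme \<Rightarrow> ('b \<Rightarrow> 'a \<Rightarrow> 'a) \<Rightarrow> ('a \<times> 'b) monoid" where
  "semidirect_product N Q \<phi> =
    \<lparr>carrier = carrier N \<times> carrier Q,
     monoid.mult = (\<lambda>(a, x) (b, y). (a \<otimes>\<^bsub>N\<^esub> \<phi> x b, x \<otimes>\<^bsub>Q\<^esub> y)),
     one = (\<one>\<^bsub>N\<^esub>, \<one>\<^bsub>Q\<^esub>)\<rparr>"

lemma group_semidirect_product:
  assumes N: "group N" and Q: "group Q"
    and hom: "\<And>x. x \<in> carrier Q \<Longrightarrow> \<phi> x \<in> hom N N"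
    and act_one: "\<And>a. a \<in> carrier N \<Longrightarrow> \<phi> \<one>\<^bsub>Q\<^esub> a = a"
    and act_mult: "\<And>x y a. \<lbrakk>x \<in> carrier Q; y \<in> carrier Q; a \<in> carrier N\<rbrakk>
      \<Longrightarrow> \<phi> (x \<otimes>\<^bsub>Q\<^esub> y) a = \<phi> x (\<phi> y a)"
  shows "group (semidirect_product N Q \<phi>)"
proof -
  interpret N: group N by (rule N)
  interpret Q: group Q by (rule Q)
  have cl: "\<phi> x a \<in> carrier N" if "x \<in> carrier Q" "a \<in> carrier N" for x a
    using hom[OF that(1)] that(2) by (auto simp: hom_def)
  have mult: "\<phi> x (a \<otimes>\<^bsub>N\<^esub> b) = \<phi> x a \<otimes>\<^bsub>N\<^esub> \<phi> x b"
    if "x \<in> carrier Q" "a \<in> carrier N" "b \<in> carrier N" for x a b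
    using hom[OF that(1)] that(2,3) by (auto simp: hom_def)
  show ?thesis
  proof (rule groupI)
    fix u assume "u \<in> carrier (semidirect_product N Q \<phi>)"
    then obtain a x where u: "u = (a, x)" and a: "a \<in> carrier N" and x: "x \<in> carrier Q"
      by (auto simp: semidirect_product_def)
    have "(\<phi> (inv\<^bsub>Q\<^esub> x) (inv\<^bsub>N\<^esub> a), inv\<^bsub>Q\<^esub> x) \<otimes>\<^bsub>semidirect_product N Q \<phi>\<^esub> u
        = \<one>\<^bsub>semidirect_product N Q \<phi>\<^esub>"
      using a x cl mult[of "inv\<^bsub>Q\<^esub> x" "inv\<^bsub>N\<^esub> a" a] hom_one[OF hom N N, of "inv\<^bsub>Q\<^esub> x"]
      by (simp add: u semidirect_product_def)
    moreover have "(\<phi> (inv\<^bsub>Q\<^esub> x) (inv\<^bsub>N\<^esub> a), inv\<^bsub>Q\<^esub> x) \<in> carrier (semidirect_product N Q \<phi>)"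
      using a x cl by (simp add: semidirect_product_def)
    ultimately show "\<exists>v\<in>carrier (semidirect_product N Q \<phi>).
        v \<otimes>\<^bsub>semidirect_product N Q \<phi>\<^esub> u = \<one>\<^bsub>semidirect_product N Q \<phi>\<^esub>"
      by blast
  qed (auto simp: semidirect_product_def cl mult act_one act_mult N.m_assoc Q.m_assoc)
qed

definition lamp_base :: "nat \<Rightarrow> nat \<Rightarrow> (int \<Rightarrow> nat \<Rightarrow> int) monoid" where
  "lamp_base p n =
    sum_group (UNIV :: int set) (\<lambda>_. product_group {..<n} (\<lambda>_. integer_mod_group p))"

definition shift :: "int \<Rightarrow> (int \<Rightarrow> 'a) \<Rightarrow> (int \<Rightarrow> 'a)" where
  "shift k f = (\<lambda>j. f (j - k))"

definition lamplighter :: "nat \<Rightarrow> nat \<Rightarrow> ((int \<Rightarrow> nat \<Rightarrow> int) \<times> int) monoid" where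
  "lamplighter p n = semidirect_product (lamp_base p n) integer_group shift"

lemma group_lamplighter: "group (lamplighter p n)"
  unfolding lamplighter_def
proof (rule group_semidirect_product)
  have G: "group (product_group {..<n} (\<lambda>_. integer_mod_group p))"
    by simp
  show "group (lamp_base p n)"
    unfolding lamp_base_def using G by simp
  show "shift k \<in> hom (lamp_base p n) (lamp_base p n)" for k
  proof (rule homI)
    fix f assume "f \<in> carrier (lamp_base p n)"
    moreover have "{i. f (i - k) \<noteq> z} = (\<lambda>i. i + k) ` {i. f i \<noteq> z}" for z
      by (auto simp: image_iff intro!: exI[of _ "_ - k"])
    ultimately show "shift k f \<in> carrier (lamp_base p n)"
      using G by (auto simp: lamp_base_def carrier_sum_group shift_def PiE_iff)
  next
    fix f g
    show "shift k (f \<otimes>\<^bsub>lamp_base p n\<^esub> g)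
        = shift k f \<otimes>\<^bsub>lamp_base p n\<^esub> shift k g"
      by (simp add: lamp_base_def shift_def fun_eq_iff)
  qed
qed (auto simp: shift_def fun_eq_iff algebra_simps)

text \<open>The value is \<open>\<infinity>\<close>, the infimum of the empty set, if \<open>H\<close> is not finitely generated.\<close>

definition min_generators :: "('a, 'b) monoid_scheme \<Rightarrow> 'a set \<Rightarrow> enat" where
  "min_generators G H = Inf {enat (card S) | S. finite S \<and> S \<subseteq> H \<and> generate G S = H}"

definition subgroup_index :: "('a, 'b) monoid_scheme \<Rightarrow> 'a set \<Rightarrow> nat" where
  "subgroup_index G H = card (rcosets\<^bsub>G\<^esub> H)"

definition descending_finite_index_chain :: "('a, 'b) monoid_scheme \<Rightarrow> (nat \<Rightarrow> 'a set) \<Rightarrow> bool" where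
  "descending_finite_index_chain G H \<longleftrightarrow>
    (\<forall>i\<ge>1. subgroup (H i) G \<and> finite (rcosets\<^bsub>G\<^esub> (H i)) \<and> H (Suc i) \<subseteq> H i)"

text \<open>\<open>RG(G, {H\<^sub>i}) = r\<close>, as a relation so that it includes the existence of the limit.\<close>

definition has_rank_gradient :: "('a, 'b) monoid_scheme \<Rightarrow> (nat \<Rightarrow> 'a set) \<Rightarrow> ereal \<Rightarrow> bool" where
  "has_rank_gradient G H r \<longleftrightarrow>
    (\<lambda>i. (ereal_of_enat (min_generators G (H i)) - 1) / ereal (real (subgroup_index G (H i))))
      \<longlonglongrightarrow> r"

definition has_trivial_core :: "('a, 'b) monoid_scheme \<Rightarrow> (nat \<Rightarrow> 'a set) \<Rightarrow> bool" where
  "has_trivial_core G H \<longleftrightarrow>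
    (\<forall>N. N \<lhd> G \<and> N \<subseteq> (\<Inter>i\<in>{1..}. H i) \<longrightarrow> N = {\<one>\<^bsub>G\<^esub>})"

end

theory Submission
  imports Defs
begin

text \<open>Let \<open>A\<close> be the base group, a free module of rank \<open>n\<close> over \<open>\<int>/p[t, 1/t]\<close>, and let \<open>H\<close> be a
  subgroup of finite index with \<open>B = A \<inter> H\<close>, projecting onto \<open>k\<int>\<close>. Then \<open>H\<close> is generated by \<open>B\<close> and
  one element above \<open>k\<close>, the index of \<open>H\<close> is \<open>k [A : B]\<close>, and \<open>B\<close> needs exactly \<open>k n\<close> generators as a
  module over \<open>\<int>/p[t\<^sup>k, 1/t\<^sup>k]\<close>, so \<open>d(H) = k n + 1\<close>. Hence \<open>(d(H) - 1) / [G : H] = n / [A : B]\<close>, and the rank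
  gradient of a chain vanishes iff the indices \<open>[A : A \<inter> H\<^sub>i]\<close> are unbounded. If they are bounded, the
  groups \<open>A \<inter> H\<^sub>i\<close> stabilise to a subgroup of finite index invariant under some \<open>t\<^sup>k\<close>, which contains
  a nonzero submodule of \<open>A\<close>, a normal subgroup in the core. Conversely a nontrivial normal subgroup in
  the core meets \<open>A\<close> in a nonzero submodule, which for \<open>n = 1\<close> is a nonzero ideal and so has finite
  index in \<open>A\<close>.\<close>

section \<open>Cosets and quotients of exponent \<open>p\<close>\<close>

lemma (in group) rcos_eq_iff:
  assumes "subgroup H G" "x \<in> carrier G" "y \<in> carrier G"
  shows "H #> x = H #> y \<longleftrightarrow> x \<otimes> inv y \<in> H"
proof
  assume "H #> x = H #> y"
  then have "x \<in> H #> y" using rcos_self assms by metis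
  then show "x \<otimes> inv y \<in> H" using assms subgroup.rcos_module_imp[OF assms(1) is_group] by blast
next
  assume "x \<otimes> inv y \<in> H"
  then have "x \<in> H #> y" using assms subgroup.rcos_module_rev[OF assms(1) is_group] by blast
  then show "H #> x = H #> y" using repr_independence assms by metis
qed

lemma rcosets_image: "rcosets\<^bsub>G\<^esub> H = (\<lambda>x. H #>\<^bsub>G\<^esub> x) ` carrier G"
  by (auto simp: RCOSETS_def)

lemma (in group) obtain_transversal:
  obtains R where "R \<subseteq> carrier G" "bij_betw (\<lambda>x. H #> x) R (rcosets H)"
  using subset_image_inj[of "rcosets H" "\<lambda>x. H #> x" "carrier G"]
  by (auto simp: rcosets_image bij_betw_def)

text \<open>Sending each coset of \<open>K\<close> to the coset of \<open>H\<close> containing it is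
  a surjection, which bounds the index of \<open>H\<close>. If the indices agree it is injective,
  and any \<open>h\<close> in \<open>H\<close> has the same image as \<open>\<one>\<close>, hence
  lies in \<open>K\<close>.\<close>

lemma (in group) finite_rcosets_mono:
  assumes "subgroup K G" "subgroup H G" "K \<subseteq> H" "finite (rcosets K)"
  shows "finite (rcosets H) \<and> card (rcosets H) \<le> card (rcosets K) \<and>
    (card (rcosets H) = card (rcosets K) \<longrightarrow> H = K)"
proof -
  \<comment> \<open>A representative of the coset is chosen; the next fact shows that the value does
    not depend on the choice.\<close>
  define f where "f C = H #> (SOME x. x \<in> carrier G \<and> K #> x = C)" for C
  have f: "f (K #> x) = H #> x" if "x \<in> carrier G" for x
  proof -
    define y where "y = (SOME y. y \<in> carrier G \<and> K #> y = K #> x)"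
    have y: "y \<in> carrier G \<and> K #> y = K #> x"
      unfolding y_def by (rule someI[of _ x]) (use that in simp)
    then have "y \<otimes> inv x \<in> H"
      using that assms rcos_eq_iff[of K y x] by auto
    then show ?thesis
      using that y assms rcos_eq_iff[of H y x] by (simp add: f_def y_def)
  qed
  have im: "rcosets H = f ` (rcosets K)"
    by (auto simp: rcosets_image image_image f)
  have "H = K" if eq: "card (rcosets H) = card (rcosets K)"
  proof
    show "H \<subseteq> K"
    proof
      fix h assume h: "h \<in> H"
      then have hG: "h \<in> carrier G" using assms(2) subgroup.mem_carrier by metis
      have inj: "inj_on f (rcosets K)"
        using eq_card_imp_inj_on[OF assms(4), of f] eq by (simp add: im)
      have "f (K #> h) = f (K #> \<one>)"
        using h hG assms(2) by (simp add: f rcos_eq_iff)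
      then have "K #> h = K #> \<one>"
        using inj hG by (auto simp: rcosets_image dest: inj_onD)
      then show "h \<in> K" using hG assms(1) rcos_eq_iff[of K h \<one>] by simp
    qed
  qed (fact assms(3))
  then show ?thesis
    using assms(4) card_image_le[OF assms(4), of f] by (simp add: im)
qed

text \<open>Multiplication by the powers of one generator enlarges the subgroup generated by the
  others by a factor of at most \<open>p\<close>.\<close>

lemma (in comm_group) card_generate_exponent_le:
  assumes "finite S" "S \<subseteq> carrier G" "p > 0" "\<And>x. x \<in> carrier G \<Longrightarrow> x [^] (p::nat) = \<one>"
  shows "finite (generate G S) \<and> card (generate G S) \<le> p ^ card S"
  using assms(1,2)
proof (induction S rule: finite_induct)
  case empty
  then show ?case by (simp add: generate_empty)
next
  case (insert a S)
  let ?D = "generate G S"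
  let ?E = "(\<lambda>(i, x). a [^] (i::nat) \<otimes> x) ` ({..<p} \<times> ?D)"
  have a: "a \<in> carrier G" and S: "S \<subseteq> carrier G" using insert by auto
  have D: "?D \<subseteq> carrier G" by (rule generate_incl[OF S])
  \<comment> \<open>Exponents are reduced modulo \<open>p\<close> once and for all, so the cases
    below may use any \<open>i\<close>.\<close>
  have E: "a [^] i \<otimes> x \<in> ?E" if "x \<in> ?D" for i :: nat and x
  proof -
    have "a [^] i = a [^] (p * (i div p) + i mod p)" by simp
    also have "\<dots> = (a [^] p) [^] (i div p) \<otimes> a [^] (i mod p)"
      using a by (simp only: nat_pow_pow nat_pow_mult)
    also have "\<dots> = a [^] (i mod p)" using a assms(4) by simp
    finally show ?thesis
      using that assms(3) by (auto intro!: image_eqI[where x = "(i mod p, x)"])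
  qed
  have inD: "s \<in> ?E" if "s \<in> ?D" for s
  proof -
    have "a [^] (0::nat) \<otimes> s = s" using that D by auto
    then show ?thesis using E[OF that, of 0] by (simp only:)
  qed
  have sub: "generate G (insert a S) \<subseteq> ?E"
  proof
    fix x assume "x \<in> generate G (insert a S)"
    then show "x \<in> ?E"
    proof (induction rule: generate.induct)
      case one
      then show ?case using inD generate.one by metis
    next
      case (incl h)
      then show ?case
      proof (cases "h = a")
        case True
        then have "h = a [^] (1::nat) \<otimes> \<one>" using a by simp
        then show ?thesis using E[OF generate.one, of 1] by (simp only:)
      next
        case False
        then show ?thesis using incl inD generate.incl by (metis insertE)
      qed
    next
      case (inv h)
      have "inv a = a [^] (p - 1)"
        using a assms(3) assms(4)[of a] by (intro inv_equality) (simp_all flip: nat_pow_Suc)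
      then show ?case
      proof (cases "h = a")
        case True
        then have "inv h = a [^] (p - 1) \<otimes> \<one>" using a \<open>inv a = a [^] (p - 1)\<close> by simp
        then show ?thesis using E[OF generate.one, of "p - 1"] by (simp only:)
      next
        case False
        then show ?thesis using inv inD generate.inv by (metis insertE)
      qed
    next
      case (eng h1 h2)
      then obtain i x j y where h: "h1 = a [^] (i::nat) \<otimes> x" "x \<in> ?D" "h2 = a [^] (j::nat) \<otimes> y" "y \<in> ?D"
        by auto
      have "h1 \<otimes> h2 = a [^] (i + j) \<otimes> (x \<otimes> y)"
        using h a D by (simp add: nat_pow_mult[symmetric] m_ac subset_iff)
      then show ?case
        using E[OF generate.eng[OF h(2,4)]] by simp
    qed
  qed
  have fin: "finite ?E" using insert S by auto
  have "card (generate G (insert a S)) \<le> card ?E" by (rule card_mono[OF fin sub])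
  also have "\<dots> \<le> p * card ?D"
    using insert S card_image_le[of "{..<p} \<times> ?D" "\<lambda>(i, x). a [^] (i::nat) \<otimes> x"]
    by (simp add: card_cartesian_product)
  also have "\<dots> \<le> p * p ^ card S" using insert S by simp
  also have "\<dots> = p ^ card (insert a S)" using insert(1,2) by simp
  finally show ?case using finite_subset[OF sub fin] by simp
qed

text \<open>Commutators in \<open>L\<close> make \<open>L\<close> normal with abelian quotient. In
  that quotient \<open>p\<close>-th powers multiply, so it is enough to control them on two factors
  of each element. The quotient then has exponent \<open>p\<close> and is generated by the image of
  \<open>S\<close>, and \<open>W\<close> embeds into it.\<close>

lemma (in group) card_le_exponent_quotient:
  assumes S: "finite S" "S \<subseteq> carrier G" "generate G S = carrier G" and L: "subgroup L G" and p: "p > 0"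
    and comm: "\<And>x y. x \<in> carrier G \<Longrightarrow> y \<in> carrier G \<Longrightarrow> (x \<otimes> y) \<otimes> inv (y \<otimes> x) \<in> L"
    and pow: "\<And>x. x \<in> carrier G \<Longrightarrow> \<exists>y\<in>carrier G. \<exists>z\<in>carrier G. x = y \<otimes> z \<and> y [^] (p::nat) \<in> L \<and> z [^] p \<in> L"
    and W: "W \<subseteq> carrier G" "\<And>v w. v \<in> W \<Longrightarrow> w \<in> W \<Longrightarrow> v \<otimes> inv w \<in> L \<Longrightarrow> v = w"
  shows "finite W \<and> card W \<le> p ^ card S"
proof -
  have LG: "L \<subseteq> carrier G" using L subgroup.subset by blast
  have "L \<lhd> G"
  proof (rule normal_invI[OF L])
    fix x h assume xh: "x \<in> carrier G" "h \<in> L"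
    then have h: "h \<in> carrier G" using LG by auto
    \<comment> \<open>A conjugate of \<open>h\<close> is a commutator times
      \<open>h\<close>.\<close>
    have "(x \<otimes> h) \<otimes> inv (h \<otimes> x) \<otimes> h \<in> L"
      using comm[OF xh(1) h] xh(2) L by (simp add: subgroup.m_closed)
    also have "(x \<otimes> h) \<otimes> inv (h \<otimes> x) \<otimes> h = x \<otimes> h \<otimes> inv x"
      using xh h by (simp add: inv_mult_group m_assoc)
    finally show "x \<otimes> h \<otimes> inv x \<in> L" .
  qed
  then interpret L: normal L G .
  interpret Q: group "G Mod L" by (rule L.factorgroup_is_group)
  interpret h: group_hom G "G Mod L" "(#>) L"
    by (intro group_hom.intro group_hom_axioms.intro L.r_coset_hom_Mod) (unfold_locales)
  have "comm_group (G Mod L)"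
  proof (rule Q.group_comm_groupI)
    fix U U' assume "U \<in> carrier (G Mod L)" "U' \<in> carrier (G Mod L)"
    then obtain x y where xy: "x \<in> carrier G" "y \<in> carrier G" "U = L #> x" "U' = L #> y"
      by (auto simp: carrier_FactGroup)
    then have "L #> (x \<otimes> y) = L #> (y \<otimes> x)"
      by (subst rcos_eq_iff[OF L]) (use comm in auto)
    then show "U \<otimes>\<^bsub>G Mod L\<^esub> U' = U' \<otimes>\<^bsub>G Mod L\<^esub> U"
      by (simp only: xy(3,4) h.hom_mult[OF xy(1,2), symmetric] h.hom_mult[OF xy(2,1), symmetric])
  qed
  then interpret Q: comm_group "G Mod L" .
  have one: "L #> x = \<one>\<^bsub>G Mod L\<^esub>" if "x \<in> L" for x
    using that LG by (simp add: coset_join2[OF _ L] subset_iff)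
  have "U [^]\<^bsub>G Mod L\<^esub> p = \<one>\<^bsub>G Mod L\<^esub>" if U: "U \<in> carrier (G Mod L)" for U
  proof -
    obtain x where x: "x \<in> carrier G" "U = L #> x" using U by (auto simp: carrier_FactGroup)
    obtain y z where yz: "y \<in> carrier G" "z \<in> carrier G" "x = y \<otimes> z" "y [^] p \<in> L" "z [^] p \<in> L"
      using pow[OF x(1)] by blast
    have "U [^]\<^bsub>G Mod L\<^esub> p = (L #> y) [^]\<^bsub>G Mod L\<^esub> p \<otimes>\<^bsub>G Mod L\<^esub> (L #> z) [^]\<^bsub>G Mod L\<^esub> p"
      using x(2) yz h.hom_closed by (simp add: Q.nat_pow_distrib del: mult_FactGroup)
    also have "\<dots> = \<one>\<^bsub>G Mod L\<^esub>"
      using yz one[OF yz(4)] one[OF yz(5)] by (simp add: h.hom_nat_pow[symmetric] del: mult_FactGroup one_FactGroup)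
    finally show ?thesis .
  qed
  moreover have "generate (G Mod L) ((#>) L ` S) = carrier (G Mod L)"
    using h.generate_img[OF S(2)] S(3) by (simp add: carrier_FactGroup)
  moreover have "(#>) L ` S \<subseteq> carrier (G Mod L)"
    using S(2) by (auto simp: carrier_FactGroup)
  ultimately have Q: "finite (carrier (G Mod L)) \<and> card (carrier (G Mod L)) \<le> p ^ card ((#>) L ` S)"
    using Q.card_generate_exponent_le[of "(#>) L ` S" p] S(1) p by simp
  have inj: "inj_on ((#>) L) W"
    using W by (intro inj_onI) (simp add: rcos_eq_iff[OF L] subset_iff)
  have sub: "(#>) L ` W \<subseteq> carrier (G Mod L)" using W(1) by (auto simp: carrier_FactGroup)
  have "finite W" using finite_imageD[OF finite_subset[OF sub] inj] Q by blast
  moreover have "card W \<le> card (carrier (G Mod L))"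
    using card_inj_on_le[OF inj sub] Q by blast
  moreover have "p ^ card ((#>) L ` S) \<le> p ^ card S"
    using p S(1) by (intro power_increasing card_image_le) auto
  ultimately show ?thesis using Q by linarith
qed

text \<open>Comparing the two chains \<open>\<sigma> B \<le> \<sigma> A \<le> A\<close> and \<open>\<sigma> B \<le> B \<le> A\<close>: since
  \<open>[\<sigma> A : \<sigma> B] = [A : B]\<close>, the index of \<open>\<sigma> B\<close> in \<open>B\<close> is that of \<open>\<sigma> A\<close> in \<open>A\<close>.\<close>

lemma (in comm_group) endomorphism_index:
  assumes \<sigma>: "\<sigma> \<in> hom G G" "inj_on \<sigma> (carrier G)"
    and B: "subgroup B G" "\<sigma> ` B \<subseteq> B" "finite (rcosets B)"
    and V: "finite V" "V \<subseteq> carrier G"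
      "\<And>v w. v \<in> V \<Longrightarrow> w \<in> V \<Longrightarrow> v \<otimes> inv w \<in> \<sigma> ` carrier G \<Longrightarrow> v = w"
  obtains W where "W \<subseteq> B" "finite W" "card W = card V"
    "\<And>v w. v \<in> W \<Longrightarrow> w \<in> W \<Longrightarrow> v \<otimes> inv w \<in> \<sigma> ` B \<Longrightarrow> v = w"
proof -
  interpret \<sigma>: group_hom G G \<sigma>
    using \<sigma>(1) by (intro group_hom.intro group_hom_axioms.intro) (auto intro: is_group)
  let ?M = "\<sigma> ` B"
  have M: "subgroup ?M G" by (rule \<sigma>.subgroup_img_is_subgroup[OF B(1)])
  have BG: "B \<subseteq> carrier G" using B(1) subgroup.subset by blast
  obtain R where R: "R \<subseteq> carrier G" "bij_betw (\<lambda>x. B #> x) R (rcosets B)"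
    by (rule obtain_transversal)
  have Rfin: "finite R" using R(2) B(3) bij_betw_finite by blast
  have Rinj: "r = s" if "r \<in> R" "s \<in> R" "r \<otimes> inv s \<in> B" for r s
    using that R rcos_eq_iff[OF B(1), of r s] by (auto simp: bij_betw_def inj_on_def subset_iff)
  have "\<exists>r\<in>R. x \<otimes> inv r \<in> B" if "x \<in> carrier G" for x
  proof -
    have "B #> x \<in> (\<lambda>x. B #> x) ` R"
      using that R(2) by (auto simp: bij_betw_def rcosets_image)
    then obtain r where "r \<in> R" "B #> x = B #> r" by blast
    then show ?thesis using that R(1) rcos_eq_iff[OF B(1), of x r] by blast
  qed
  then obtain \<rho> where \<rho>: "\<And>x. x \<in> carrier G \<Longrightarrow> \<rho> x \<in> R \<and> x \<otimes> inv (\<rho> x) \<in> B"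
    by metis
  have "R \<noteq> {}" using \<rho>[of \<one>] by auto
  \<comment> \<open>\<open>U\<close> represents each coset of \<open>?M\<close> in \<open>B\<close>
    once. If it is infinite it has subsets of every finite size, so only the finite case needs a
    count.\<close>
  obtain U where U: "U \<subseteq> B" "inj_on (\<lambda>b. ?M #> b) U" "(\<lambda>b. ?M #> b) ` B = (\<lambda>b. ?M #> b) ` U"
    using subset_image_inj[of "(\<lambda>b. ?M #> b) ` B" "\<lambda>b. ?M #> b" B] by auto
  have Uinj: "v = w" if "v \<in> U" "w \<in> U" "v \<otimes> inv w \<in> ?M" for v w
    using that U(1,2) BG rcos_eq_iff[OF M, of v w] by (auto simp: inj_on_def subset_iff)
  have "card V \<le> card U" if fin: "finite U"
  proof -
    \<comment> \<open>The products \<open>v \<otimes> \<sigma> r\<close> are pairwise incongruent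
      modulo \<open>?M\<close>. The code \<open>f y\<close> consists of a representative modulo
      \<open>B\<close> and a coset of \<open>?M\<close> in \<open>B\<close>, and equal codes imply
      congruence modulo \<open>?M\<close>; hence
      \<open>card V * card R \<le> card R * card U\<close>.\<close>
    define g where "g = (\<lambda>(v, r). v \<otimes> \<sigma> r)"
    define f where "f y = (\<rho> y, ?M #> (y \<otimes> inv (\<rho> y)))" for y
    have gc: "g z \<in> carrier G" if "z \<in> V \<times> R" for z
      using that V(2) R(1) \<sigma>.hom_closed by (auto simp: g_def subset_iff)
    have sub: "(\<lambda>z. f (g z)) ` (V \<times> R) \<subseteq> R \<times> (\<lambda>b. ?M #> b) ` B"
      using \<rho> gc by (auto simp: f_def)
    have inj: "inj_on (\<lambda>z. f (g z)) (V \<times> R)"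
    proof (rule inj_onI)
      fix z z' assume z: "z \<in> V \<times> R" and z': "z' \<in> V \<times> R" and eq: "f (g z) = f (g z')"
      obtain v r v' r' where vr: "z = (v, r)" "z' = (v', r')" "v \<in> V" "v' \<in> V" "r \<in> R" "r' \<in> R"
        using z z' by blast
      have c: "v \<in> carrier G" "v' \<in> carrier G" "r \<in> carrier G" "r' \<in> carrier G"
        using vr V(2) R(1) by auto
      let ?r = "\<rho> (g z)"
      have rc: "?r \<in> carrier G" using \<rho> gc[OF z] R(1) by auto
      have "?M #> (g z \<otimes> inv ?r) = ?M #> (g z' \<otimes> inv ?r)"
        using eq unfolding f_def by (metis prod.inject)
      then have "g z \<otimes> inv ?r \<otimes> inv (g z' \<otimes> inv ?r) \<in> ?M"
        using rcos_eq_iff[OF M] gc[OF z] gc[OF z'] rc by simp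
      also have "g z \<otimes> inv ?r \<otimes> inv (g z' \<otimes> inv ?r) = g z \<otimes> inv (g z')"
      proof -
        have "inv ?r \<otimes> (?r \<otimes> inv (g z')) = inv (g z')"
          using gc[OF z'] rc by (simp flip: m_assoc)
        then show ?thesis using gc[OF z] gc[OF z'] rc by (simp add: inv_mult_group m_assoc)
      qed
      finally have gM: "g z \<otimes> inv (g z') \<in> ?M" .
      have geq: "g z \<otimes> inv (g z') = (v \<otimes> inv v') \<otimes> \<sigma> (r \<otimes> inv r')"
        using c vr(1,2) by (simp add: g_def inv_mult_group m_ac)
      then obtain b where b: "b \<in> B" "(v \<otimes> inv v') \<otimes> \<sigma> (r \<otimes> inv r') = \<sigma> b" using gM by auto
      then have bc: "b \<in> carrier G" using BG by auto
      have "v \<otimes> inv v' = \<sigma> b \<otimes> inv (\<sigma> (r \<otimes> inv r'))"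
        using b(2) c bc by (intro inv_solve_right[THEN iffD2]) simp_all
      also have "\<dots> = \<sigma> (b \<otimes> inv (r \<otimes> inv r'))"
        using c bc by simp
      finally have "v \<otimes> inv v' \<in> \<sigma> ` carrier G"
        by (rule image_eqI) (use c bc in simp)
      then have "v = v'" by (rule V(3)[OF vr(3,4)])
      then have "\<sigma> (r \<otimes> inv r') = \<sigma> b" using b c by simp
      then have "r \<otimes> inv r' = b" by (rule inj_onD[OF \<sigma>(2)]) (use c bc in auto)
      then show "z = z'" using Rinj[OF vr(5,6)] b(1) \<open>v = v'\<close> vr by auto
    qed
    have "card (V \<times> R) \<le> card (R \<times> (\<lambda>b. ?M #> b) ` B)"
      using Rfin fin by (intro card_inj_on_le[OF inj sub]) (simp add: U(3))
    also have "card (R \<times> (\<lambda>b. ?M #> b) ` B) = card R * card U"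
      using U by (simp add: card_cartesian_product card_image)
    finally show ?thesis using Rfin \<open>R \<noteq> {}\<close> by (simp add: card_cartesian_product mult.commute card_gt_0_iff)
  qed
  then obtain W where "W \<subseteq> U" "finite W" "card W = card V"
    using obtain_subset_with_card_n[of "card V" U] infinite_arbitrarily_large[of U "card V"]
    by (metis finite_subset)
  then show thesis by (intro that[of W]) (use Uinj U(1) in blast)+
qed

lemma finite_int_bounds:
  fixes S :: "int set" assumes "finite S" obtains l where "l \<ge> 0" "S \<subseteq> {-l..<l}"
proof
  \<comment> \<open>A sum serves as the bound since, unlike a maximum, it also covers the empty
    set.\<close>
  show "S \<subseteq> {- (\<Sum>q\<in>S. \<bar>q\<bar> + 1)..<(\<Sum>q\<in>S. \<bar>q\<bar> + 1)}"
  proof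
    fix q assume "q \<in> S"
    then have "\<bar>q\<bar> + 1 \<le> (\<Sum>q\<in>S. \<bar>q\<bar> + 1)"
      using assms by (intro member_le_sum) auto
    then show "q \<in> {- (\<Sum>q\<in>S. \<bar>q\<bar> + 1)..<(\<Sum>q\<in>S. \<bar>q\<bar> + 1)}" by auto
  qed
qed (auto intro: sum_nonneg)

section \<open>Coordinates on the base group\<close>

locale lamp =
  fixes p n :: nat
  assumes prime_p: "Factorial_Ring.prime p" and n_pos: "n \<ge> 1"
begin

abbreviation "A \<equiv> lamp_base p n"
abbreviation "G \<equiv> lamplighter p n"

text \<open>Coordinate \<open>i < n\<close> of the value at \<open>j\<close> is numbered \<open>j n + i\<close>. This turns the base group
  into the finitely supported functions \<open>\<int> \<rightarrow> \<int>/p\<close>, with \<open>shift k\<close> translating by \<open>k n\<close>.\<close>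

definition coord :: "(int \<Rightarrow> nat \<Rightarrow> int) \<Rightarrow> int \<Rightarrow> int" where
  "coord a q = a (q div int n) (nat (q mod int n))"

definition supp :: "(int \<Rightarrow> nat \<Rightarrow> int) \<Rightarrow> int set" where
  "supp a = {q. coord a q \<noteq> 0}"

lemma p_gt_1: "p > 1"
  using prime_p by (rule prime_gt_1_nat)

lemma p_pos: "p > 0"
  using p_gt_1 by simp

lemma coord_eq: "i < n \<Longrightarrow> a j i = coord a (j * int n + int i)"
  by (simp add: coord_def)

lemma nat_mod_less: "nat (q mod int n) < n"
  using n_pos by (simp add: nat_less_iff)

lemma mem_A_iff:
  "a \<in> carrier A \<longleftrightarrow> (\<forall>j. a j \<in> {..<n} \<rightarrow>\<^sub>E {0..<int p}) \<and> finite {j. a j \<noteq> (\<lambda>i\<in>{..<n}. 0)}"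
proof -
  have "group (product_group {..<n} (\<lambda>_. integer_mod_group p))" by simp
  then show ?thesis
    using p_pos by (simp add: lamp_base_def carrier_sum_group carrier_integer_mod_group PiE_iff)
qed

lemma coord_range: "a \<in> carrier A \<Longrightarrow> 0 \<le> coord a q \<and> coord a q < int p"
  using nat_mod_less[of q] by (auto simp: mem_A_iff coord_def PiE_iff Ball_def)

lemma coord_mod: "a \<in> carrier A \<Longrightarrow> coord a q mod int p = coord a q"
  using coord_range by simp

lemma finite_supp: 
  assumes "a \<in> carrier A" shows "finite (supp a)"
proof -
  have "supp a \<subseteq> (\<lambda>(j,i). j * int n + int i) ` ({j. a j \<noteq> (\<lambda>i\<in>{..<n}. 0)} \<times> {..<n})"
  proof
    fix q assume "q \<in> supp a"
    then have "a (q div int n) \<noteq> (\<lambda>i\<in>{..<n}. 0)"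
      using nat_mod_less[of q] by (auto simp: supp_def coord_def)
    moreover have "q = (q div int n) * int n + int (nat (q mod int n))"
      using n_pos by simp
    ultimately show "q \<in> (\<lambda>(j,i). j * int n + int i) ` ({j. a j \<noteq> (\<lambda>i\<in>{..<n}. 0)} \<times> {..<n})"
      using nat_mod_less[of q] by (intro image_eqI[where x="(q div int n, nat (q mod int n))"]) (simp_all del: int_nat_eq)
  qed
  moreover have "finite {j. a j \<noteq> (\<lambda>i\<in>{..<n}. 0)}"
    using assms by (simp add: mem_A_iff)
  ultimately show ?thesis
    by (meson finite_SigmaI finite_imageI finite_lessThan finite_subset)
qed

text \<open>\<open>coord\<close> only sees arguments below \<open>n\<close>; at all others both
  functions are \<open>undefined\<close> by extensionality.\<close>

lemma coord_ext:
  assumes "a \<in> carrier A" "b \<in> carrier A" "\<And>q. coord a q = coord b q"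
  shows "a = b"
proof
  fix j
  have "a j i = b j i" if "i \<in> {..<n}" for i
    using that assms(3) coord_eq[of i a j] coord_eq[of i b j] by simp
  then show "a j = b j"
    using assms(1,2) by (intro PiE_ext[of _ "{..<n}" "\<lambda>_. {0..<int p}"]) (auto simp: mem_A_iff)
qed

lemma coord_surj:
  assumes "finite {q. f q \<noteq> 0}" "\<And>q. 0 \<le> f q \<and> f q < int p"
  obtains a where "a \<in> carrier A" "\<And>q. coord a q = f q"
proof
  define a where "a = (\<lambda>j. \<lambda>i\<in>{..<n}. f (j * int n + int i))"
  have "{j. a j \<noteq> (\<lambda>i\<in>{..<n}. 0)} \<subseteq> (\<lambda>q. q div int n) ` {q. f q \<noteq> 0}"
  proof
    fix j assume "j \<in> {j. a j \<noteq> (\<lambda>i\<in>{..<n}. 0)}"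
    then obtain i where "i < n" "f (j * int n + int i) \<noteq> 0"
      by (auto simp: a_def fun_eq_iff split: if_splits)
    moreover have "j = (j * int n + int i) div int n"
      using \<open>i < n\<close> by simp
    ultimately show "j \<in> (\<lambda>q. q div int n) ` {q. f q \<noteq> 0}"
      by blast
  qed
  then have "finite {j. a j \<noteq> (\<lambda>i\<in>{..<n}. 0)}"
    using assms(1) by (meson finite_imageI finite_subset)
  then show "a \<in> carrier A"
    using assms(2) by (auto simp: mem_A_iff a_def)
  show "coord a q = f q" for q
    using nat_mod_less[of q] n_pos by (simp add: coord_def a_def)
qed

lemma group_A: "group A"
  by (simp add: lamp_base_def)

lemma coord_mult: "coord (a \<otimes>\<^bsub>A\<^esub> b) q = (coord a q + coord b q) mod int p"
  using nat_mod_less[of q] by (simp add: lamp_base_def coord_def)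

sublocale A: comm_group A
proof (rule group.group_comm_groupI[OF group_A])
  interpret group A by (rule group_A)
  fix a b assume "a \<in> carrier A" "b \<in> carrier A"
  then show "a \<otimes>\<^bsub>A\<^esub> b = b \<otimes>\<^bsub>A\<^esub> a"
    by (intro coord_ext) (auto simp: coord_mult add.commute)
qed

sublocale G: group G
  by (rule group_lamplighter)

lemma coord_one [simp]: "coord \<one>\<^bsub>A\<^esub> q = 0"
  using nat_mod_less[of q] by (simp add: lamp_base_def coord_def)

lemma coord_inv:
  assumes "a \<in> carrier A" shows "coord (inv\<^bsub>A\<^esub> a) q = (- coord a q) mod int p"
proof -
  have "(coord (inv\<^bsub>A\<^esub> a) q + coord a q) mod int p = 0"
    using coord_mult[of "inv\<^bsub>A\<^esub> a" a q] assms by simp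
  then have "(coord (inv\<^bsub>A\<^esub> a) q) mod int p = (- coord a q) mod int p"
    by (metis add_diff_cancel_right' diff_0 mod_diff_left_eq)
  then show ?thesis using assms by (simp add: coord_mod)
qed

lemma coord_pow: "a \<in> carrier A \<Longrightarrow> coord (a [^]\<^bsub>A\<^esub> (m::nat)) q = (int m * coord a q) mod int p"
  by (induction m) (simp_all add: coord_mult algebra_simps mod_add_right_eq)

lemma pow_p: "a \<in> carrier A \<Longrightarrow> a [^]\<^bsub>A\<^esub> p = \<one>\<^bsub>A\<^esub>"
  by (rule coord_ext) (auto simp: coord_pow)

lemma coord_shift: "coord (shift k a) q = coord a (q - k * int n)"
proof -
  have *: "q - k * int n = q + (- k) * int n" by simp
  have "(q - k * int n) div int n = q div int n - k"
    unfolding * using n_pos by (subst div_mult_self1) auto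
  moreover have "(q - k * int n) mod int n = q mod int n"
    unfolding * by (rule mod_mult_self1)
  ultimately show ?thesis
    by (simp add: coord_def shift_def)
qed

lemma shift_closed [simp]: "a \<in> carrier A \<Longrightarrow> shift k a \<in> carrier A"
proof -
  assume a: "a \<in> carrier A"
  have "{j. a (j - k) \<noteq> z} = (\<lambda>j. j + k) ` {j. a j \<noteq> z}" for z
    by (auto simp: image_iff intro!: exI[of _ "_ - k"])
  then show ?thesis
    using a by (auto simp: mem_A_iff shift_def)
qed

lemma shift_mult: "a \<in> carrier A \<Longrightarrow> b \<in> carrier A \<Longrightarrow> shift k (a \<otimes>\<^bsub>A\<^esub> b) = shift k a \<otimes>\<^bsub>A\<^esub> shift k b"
  by (rule coord_ext) (auto simp: coord_mult coord_shift)

lemma shift_inv: "a \<in> carrier A \<Longrightarrow> shift k (inv\<^bsub>A\<^esub> a) = inv\<^bsub>A\<^esub> (shift k a)"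
  by (rule coord_ext) (auto simp: coord_inv coord_shift)

lemma shift_one [simp]: "shift k \<one>\<^bsub>A\<^esub> = \<one>\<^bsub>A\<^esub>"
  by (rule coord_ext) (auto simp: coord_shift)

lemma shift_0 [simp]: "shift 0 a = a"
  by (simp add: shift_def)

lemma shift_shift [simp]: "shift j (shift k a) = shift (j + k) a"
  by (simp add: shift_def algebra_simps)

lemma supp_one [simp]: "supp \<one>\<^bsub>A\<^esub> = {}"
  by (simp add: supp_def)

lemma supp_mult: "supp (a \<otimes>\<^bsub>A\<^esub> b) \<subseteq> supp a \<union> supp b"
  by (auto simp: supp_def coord_mult)

lemma supp_inv: "a \<in> carrier A \<Longrightarrow> supp (inv\<^bsub>A\<^esub> a) \<subseteq> supp a"
  by (auto simp: supp_def coord_inv)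

lemma supp_pow: "a \<in> carrier A \<Longrightarrow> supp (a [^]\<^bsub>A\<^esub> (m::nat)) \<subseteq> supp a"
  by (auto simp: supp_def coord_pow)

lemma supp_empty: "a \<in> carrier A \<Longrightarrow> supp a = {} \<Longrightarrow> a = \<one>\<^bsub>A\<^esub>"
  by (rule coord_ext) (auto simp: supp_def)

text \<open>A nonzero coordinate is invertible modulo the prime \<open>p\<close>, so some multiple
  of \<open>f\<close> clears coordinate \<open>q\<close>. This is the elimination step of both
  division arguments below.\<close>

lemma cancel_coord:
  assumes a: "a \<in> carrier A" and f: "f \<in> carrier A" and "coord f q \<noteq> 0"
  obtains m :: nat where "coord (a \<otimes>\<^bsub>A\<^esub> f [^]\<^bsub>A\<^esub> m) q = 0"
proof -
  have "coprime (coord f q) (int p)"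
  proof -
    have "\<not> int p dvd coord f q"
      using coord_range[OF f, of q] assms(3) zdvd_not_zless[of "coord f q" "int p"] by auto
    then show ?thesis
      using prime_p prime_imp_coprime[of "int p" "coord f q"] by (simp add: coprime_commute)
  qed
  then obtain x y where xy: "x * coord f q + y * int p = 1"
    using bezout_int[of "coord f q" "int p"] by auto
  \<comment> \<open>\<open>x\<close> inverts \<open>coord f q\<close> modulo \<open>p\<close>;
    passing to the residue makes the exponent a natural number.\<close>
  define m where "m = nat ((- coord a q * x) mod int p)"
  have m: "int m = (- coord a q * x) mod int p"
    using p_pos by (simp add: m_def)
  have "(coord a q + int m * coord f q) mod int p = (coord a q - coord a q * x * coord f q) mod int p"
    unfolding m by (metis (no_types, lifting) diff_conv_add_uminus mod_add_right_eq mod_mult_left_eq mult_minus_left)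
  also have "coord a q - coord a q * x * coord f q = coord a q * (1 - x * coord f q)"
    by (simp add: algebra_simps)
  also have "\<dots> = (coord a q * y) * int p"
  proof -
    have "1 - x * coord f q = y * int p" using xy by simp
    then show ?thesis by simp
  qed
  finally have "(coord a q + int m * coord f q) mod int p = 0" by simp
  then have "coord (a \<otimes>\<^bsub>A\<^esub> f [^]\<^bsub>A\<^esub> m) q = 0"
    using f by (simp add: coord_mult coord_pow mod_add_right_eq)
  then show thesis ..
qed

text \<open>Reading off coordinates identifies these elements with all functions from
  \<open>I\<close> to the \<open>p\<close> residues.\<close>

lemma card_supported:
  assumes "finite I"
  shows "card {a \<in> carrier A. supp a \<subseteq> I} = p ^ card I" "finite {a \<in> carrier A. supp a \<subseteq> I}"
proof -
  have bij: "bij_betw (\<lambda>a. restrict (coord a) I) {a \<in> carrier A. supp a \<subseteq> I} (I \<rightarrow>\<^sub>E {0..<int p})"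
  proof (rule bij_betwI')
    fix a b assume a: "a \<in> {a \<in> carrier A. supp a \<subseteq> I}" and b: "b \<in> {a \<in> carrier A. supp a \<subseteq> I}"
    show "(restrict (coord a) I = restrict (coord b) I) = (a = b)"
    proof
      assume *: "restrict (coord a) I = restrict (coord b) I"
      show "a = b"
      proof (rule coord_ext)
        show "coord a q = coord b q" for q
        proof (cases "q \<in> I")
          case False
          then have "coord a q = 0" "coord b q = 0" using a b by (auto simp: supp_def)
          then show ?thesis by simp
        qed (use fun_cong[OF *, of q] in simp)
      qed (use a b in auto)
    qed simp
  next
    fix a assume "a \<in> {a \<in> carrier A. supp a \<subseteq> I}"
    then show "restrict (coord a) I \<in> I \<rightarrow>\<^sub>E {0..<int p}"
      by (auto simp: coord_range)
  next
    fix f assume f: "f \<in> I \<rightarrow>\<^sub>E {0..<int p}"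
    have "finite {q. (if q \<in> I then f q else 0) \<noteq> 0}"
      using assms by (rule rev_finite_subset) auto
    moreover have "0 \<le> (if q \<in> I then f q else 0) \<and> (if q \<in> I then f q else 0) < int p" for q
      using f p_pos by (auto simp: PiE_iff)
    ultimately obtain a where a: "a \<in> carrier A" "\<And>q. coord a q = (if q \<in> I then f q else 0)"
      by (rule coord_surj) (rule that)
    have "f = restrict (coord a) I"
      using f a(2) by (auto simp: fun_eq_iff PiE_iff extensional_def)
    moreover have "supp a \<subseteq> I"
      by (auto simp: supp_def a(2) split: if_splits)
    ultimately show "\<exists>a\<in>{a \<in> carrier A. supp a \<subseteq> I}. f = restrict (coord a) I"
      using a(1) by blast
  qed
  moreover have "finite (I \<rightarrow>\<^sub>E {0..<int p})" "card (I \<rightarrow>\<^sub>E {0..<int p}) = p ^ card I"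
    using assms by (auto intro: finite_PiE simp: card_PiE)
  ultimately show "card {a \<in> carrier A. supp a \<subseteq> I} = p ^ card I" "finite {a \<in> carrier A. supp a \<subseteq> I}"
    using bij_betw_finite[OF bij] bij_betw_same_card[OF bij] by simp_all
qed

lemma infinite_A: "infinite (carrier A)"
proof
  assume fin: "finite (carrier A)"
  \<comment> \<open>As many coordinates as \<open>A\<close> is supposed to have elements already
    yield more elements than that.\<close>
  have "card {a \<in> carrier A. supp a \<subseteq> {0..<int (card (carrier A))}} = p ^ card (carrier A)"
    by (simp add: card_supported)
  moreover have "card {a \<in> carrier A. supp a \<subseteq> {0..<int (card (carrier A))}} \<le> card (carrier A)"
    using fin by (intro card_mono) auto
  moreover have "card (carrier A) < p ^ card (carrier A)"
    using p_gt_1 by (simp add: power_gt_expt)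
  ultimately show False by simp
qed

lemma mem_G_iff [simp]: "(a, x) \<in> carrier G \<longleftrightarrow> a \<in> carrier A"
  by (simp add: lamplighter_def semidirect_product_def)

lemma one_G: "\<one>\<^bsub>G\<^esub> = (\<one>\<^bsub>A\<^esub>, 0)"
  by (simp add: lamplighter_def semidirect_product_def)

lemma mult_G [simp]: "(a, x) \<otimes>\<^bsub>G\<^esub> (b, y) = (a \<otimes>\<^bsub>A\<^esub> shift x b, x + y)"
  by (simp add: lamplighter_def semidirect_product_def)

lemma inv_G: "a \<in> carrier A \<Longrightarrow> inv\<^bsub>G\<^esub> (a, x) = (shift (- x) (inv\<^bsub>A\<^esub> a), - x)"
  by (rule G.inv_equality) (simp_all add: one_G shift_mult[symmetric])

lemma snd_pow: "g \<in> carrier G \<Longrightarrow> snd (g [^]\<^bsub>G\<^esub> (j::int)) = j * snd g"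
proof -
  assume g: "g \<in> carrier G"
  have nat: "snd (g [^]\<^bsub>G\<^esub> (m::nat)) = int m * snd g" for m
  proof (induction m)
    case (Suc m)
    have "snd (g [^]\<^bsub>G\<^esub> m \<otimes>\<^bsub>G\<^esub> g) = snd (g [^]\<^bsub>G\<^esub> m) + snd g"
      by (metis mult_G prod.collapse snd_conv)
    then show ?case using Suc by (simp add: algebra_simps)
  qed (simp add: one_G)
  show ?thesis
  proof (cases j rule: int_cases2)
    case (nonneg m)
    then show ?thesis by (simp add: nat int_pow_int)
  next
    case (nonpos m)
    obtain b y where "g [^]\<^bsub>G\<^esub> m = (b, y)" by fastforce
    then have "b \<in> carrier A" using g G.nat_pow_closed[of g m] by simp
    then show ?thesis
      using nonpos nat[of m] g by (simp add: G.int_pow_neg_int inv_G \<open>g [^]\<^bsub>G\<^esub> m = (b, y)\<close>)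
  qed
qed

end

section \<open>Base parts and the projection of a finite-index subgroup to \<int>\<close>

context lamp
begin

text \<open>The intersection of \<open>H\<close> with the base group, as a set of elements of
  \<open>A\<close> instead of pairs, so that its cosets can be formed in \<open>A\<close>.\<close>

definition base_part :: "((int \<Rightarrow> nat \<Rightarrow> int) \<times> int) set \<Rightarrow> (int \<Rightarrow> nat \<Rightarrow> int) set" where
  "base_part H = {b. (b, 0) \<in> H}"

lemma mem_base_part [simp]: "b \<in> base_part H \<longleftrightarrow> (b, 0) \<in> H"
  by (simp add: base_part_def)

lemma div_G: "b \<in> carrier A \<Longrightarrow> c \<in> carrier A \<Longrightarrow>
    (b, i) \<otimes>\<^bsub>G\<^esub> inv\<^bsub>G\<^esub> (c, j) = (b \<otimes>\<^bsub>A\<^esub> shift (i - j) (inv\<^bsub>A\<^esub> c), i - j)"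
  by (simp add: inv_G)

lemma pow_base: "b \<in> carrier A \<Longrightarrow> (b, 0) [^]\<^bsub>G\<^esub> (m::nat) = (b [^]\<^bsub>A\<^esub> m, 0)"
  by (induction m) (simp_all add: one_G)

lemma subgroup_base_part:
  assumes "subgroup H G" shows "subgroup (base_part H) A"
proof
  show "base_part H \<subseteq> carrier A"
    using subgroup.subset[OF assms] by auto
next
  fix x y assume "x \<in> base_part H" "y \<in> base_part H"
  then show "x \<otimes>\<^bsub>A\<^esub> y \<in> base_part H"
    using subgroup.m_closed[OF assms, of "(x, 0)" "(y, 0)"] by simp
next
  show "\<one>\<^bsub>A\<^esub> \<in> base_part H" using subgroup.one_closed[OF assms] by (simp add: one_G)
next
  fix x assume x: "x \<in> base_part H"
  then have "x \<in> carrier A" using subgroup.subset[OF assms] by auto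
  then show "inv\<^bsub>A\<^esub> x \<in> base_part H"
    using subgroup.m_inv_closed[OF assms, of "(x, 0)"] x by (simp add: inv_G)
qed

text \<open>The base group is abelian, so \<open>c\<close> cancels and only the shift by
  \<open>m\<close> remains.\<close>

lemma conj_base:
  assumes "c \<in> carrier A" "b \<in> carrier A"
  shows "(c, m) \<otimes>\<^bsub>G\<^esub> (b, 0) \<otimes>\<^bsub>G\<^esub> inv\<^bsub>G\<^esub> (c, m) = (shift m b, 0)"
  using assms by (simp add: div_G A.m_assoc A.m_lcomm[of c "shift m b"])

text \<open>By pigeonhole two powers of the shift lie in one coset, so \<open>H\<close> has an
  element with positive second component. The least such component divides all others by division
  with remainder.\<close>

lemma finite_index_obtain_generator:
  assumes H: "subgroup H G" and fin: "finite (rcosets\<^bsub>G\<^esub> H)"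
  obtains a k where "k > 0" "(a, int k) \<in> H" "\<And>b m. (b, m) \<in> H \<Longrightarrow> int k dvd m"
proof -
  have HG: "H \<subseteq> carrier G" using H subgroup.subset by blast
  define P where "P k \<longleftrightarrow> k > 0 \<and> (\<exists>a. (a, int k) \<in> H)" for k
  have "\<exists>k. P k"
  proof -
    let ?f = "\<lambda>j::nat. H #>\<^bsub>G\<^esub> (\<one>\<^bsub>A\<^esub>, int j)"
    have "range ?f \<subseteq> rcosets\<^bsub>G\<^esub> H" by (auto simp: rcosets_image)
    then have "finite (range ?f)" using fin finite_subset by blast
    then have "\<not> inj ?f" using finite_imageD by blast
    then obtain i j where "?f i = ?f j" "i \<noteq> j" by (auto simp: inj_on_def)
    then obtain i j where ij: "?f j = ?f i" "i < j" by (metis linorder_neqE_nat)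
    then have "(\<one>\<^bsub>A\<^esub>, int j - int i) \<in> H"
      using G.rcos_eq_iff[OF H, of "(\<one>\<^bsub>A\<^esub>, int j)" "(\<one>\<^bsub>A\<^esub>, int i)"] by (simp add: div_G)
    then have "P (j - i)" using ij(2) by (auto simp: P_def of_nat_diff)
    then show ?thesis ..
  qed
  define k where "k = (LEAST k. P k)"
  have k: "P k" unfolding k_def using \<open>\<exists>k. P k\<close> by (rule LeastI_ex)
  then obtain a where a: "(a, int k) \<in> H" by (auto simp: P_def)
  have "int k dvd m" if bm: "(b, m) \<in> H" for b m
  proof (rule ccontr)
    assume "\<not> int k dvd m"
    then have pos: "m mod int k > 0"
      using k by (simp add: P_def dvd_eq_mod_eq_0 order_le_neq_trans)
    \<comment> \<open>An element of \<open>H\<close> above the remainder \<open>m mod int k\<close>,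
      contradicting the minimality of \<open>k\<close>.\<close>
    let ?g = "(b, m) \<otimes>\<^bsub>G\<^esub> (a, int k) [^]\<^bsub>G\<^esub> (- (m div int k))"
    have "?g \<in> H"
      using bm a H by (simp add: subgroup.m_closed G.subgroup_int_pow_closed)
    moreover have "snd ?g = m mod int k"
    proof -
      obtain c y where c: "(a, int k) [^]\<^bsub>G\<^esub> (- (m div int k)) = (c, y)" by fastforce
      then have "y = - (m div int k) * int k"
        using snd_pow[of "(a, int k)" "- (m div int k)"] a HG by auto
      then show ?thesis by (simp add: c minus_div_mult_eq_mod)
    qed
    ultimately have "(fst ?g, int (nat (m mod int k))) \<in> H"
      using pos by (metis int_nat_eq less_imp_le prod.collapse)
    then have "P (nat (m mod int k))" using pos by (auto simp: P_def)
    then have "k \<le> nat (m mod int k)" unfolding k_def by (rule Least_le)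
    then have "int k \<le> m mod int k" using pos by (simp add: le_nat_iff)
    moreover have "m mod int k < int k" using k by (simp add: P_def)
    ultimately show False by linarith
  qed
  then show thesis using that k a by (auto simp: P_def)
qed

end

section \<open>Subgroups mapping onto \<open>k\<int>\<close>\<close>

text \<open>The data supplied by \<open>finite_index_obtain_generator\<close>: \<open>H\<close> is
  an extension of its base part by the infinite cyclic group generated by
  \<open>(a, int k)\<close>.\<close>

locale lamp_subgroup = lamp +
  fixes H :: "((int \<Rightarrow> nat \<Rightarrow> int) \<times> int) set" and a :: "int \<Rightarrow> nat \<Rightarrow> int" and k :: nat
  assumes subgroup_H: "subgroup H G" and k_pos: "k > 0" and gen_H: "(a, int k) \<in> H"
    and snd_dvd: "(b, m) \<in> H \<Longrightarrow> int k dvd m"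
begin

abbreviation "B \<equiv> base_part H"

lemmas subgroup_B = subgroup_base_part[OF subgroup_H]

lemma B_carrier: "b \<in> B \<Longrightarrow> b \<in> carrier A"
  using subgroup.mem_carrier[OF subgroup_B] .

lemma a_carrier [simp]: "a \<in> carrier A"
  using gen_H subgroup.mem_carrier[OF subgroup_H] by auto

text \<open>The elements of \<open>A \<rtimes> k\<int>\<close>, parametrised so that multiplication does not involve \<open>a\<close>.\<close>

definition el :: "(int \<Rightarrow> nat \<Rightarrow> int) \<Rightarrow> int \<Rightarrow> (int \<Rightarrow> nat \<Rightarrow> int) \<times> int" where
  "el x i = (x, 0) \<otimes>\<^bsub>G\<^esub> (a, int k) [^]\<^bsub>G\<^esub> i"

lemma pow_gen: "\<exists>c\<in>carrier A. (a, int k) [^]\<^bsub>G\<^esub> (i::int) = (c, int k * i)"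
proof -
  obtain c y where c: "(a, int k) [^]\<^bsub>G\<^esub> i = (c, y)" by fastforce
  moreover have "(a, int k) [^]\<^bsub>G\<^esub> i \<in> carrier G" by simp
  ultimately show ?thesis using snd_pow[of "(a, int k)" i] by (auto simp: mult.commute)
qed

lemma el_closed [simp]: "x \<in> carrier A \<Longrightarrow> el x i \<in> carrier G"
  using pow_gen[of i] by (auto simp: el_def)

lemma el_zero: "x \<in> carrier A \<Longrightarrow> el x 0 = (x, 0)"
  by (simp add: el_def one_G)

text \<open>Because the base group is abelian, the power \<open>i\<close> of
  \<open>(a, int k)\<close> acts on it as the shift by \<open>k * i\<close> whatever
  \<open>a\<close> is.\<close>

lemma el_mult:
  assumes "x \<in> carrier A" "y \<in> carrier A"
  shows "el x i \<otimes>\<^bsub>G\<^esub> el y j = el (x \<otimes>\<^bsub>A\<^esub> shift (int k * i) y) (i + j)"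
proof -
  obtain c d where c: "c \<in> carrier A" "(a, int k) [^]\<^bsub>G\<^esub> i = (c, int k * i)"
    and d: "d \<in> carrier A" "(a, int k) [^]\<^bsub>G\<^esub> j = (d, int k * j)"
    using pow_gen by meson
  have "(a, int k) [^]\<^bsub>G\<^esub> (i + j) = (c \<otimes>\<^bsub>A\<^esub> shift (int k * i) d, int k * (i + j))"
    using G.int_pow_mult[of "(a, int k)" i j] c(2) d(2) by (simp add: distrib_left)
  then show ?thesis
    using assms c d by (simp add: el_def shift_mult A.m_ac algebra_simps)
qed

lemma el_one: "el \<one>\<^bsub>A\<^esub> 0 = \<one>\<^bsub>G\<^esub>"
  by (simp add: el_zero one_G)

lemma el_inv:
  assumes "x \<in> carrier A"
  shows "inv\<^bsub>G\<^esub> (el x i) = el (shift (- (int k * i)) (inv\<^bsub>A\<^esub> x)) (- i)"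
  using assms by (intro G.inv_equality) (simp_all add: el_mult el_one flip: shift_mult)

lemma el_div:
  assumes "x \<in> carrier A" "y \<in> carrier A"
  shows "el x i \<otimes>\<^bsub>G\<^esub> inv\<^bsub>G\<^esub> (el y j) = el (x \<otimes>\<^bsub>A\<^esub> shift (int k * (i - j)) (inv\<^bsub>A\<^esub> y)) (i - j)"
  using assms by (simp add: el_inv el_mult algebra_simps)

lemma el_inject:
  assumes "el x i = el y j" "x \<in> carrier A" "y \<in> carrier A" shows "x = y \<and> i = j"
proof -
  have "int k * i = int k * j"
    using assms(1) pow_gen[of i] pow_gen[of j] by (auto simp: el_def)
  then have "i = j" using k_pos by simp
  then show ?thesis
    using assms pow_gen[of i] by (auto simp: el_def)
qed

lemma gen_pow_in: "(a, int k) [^]\<^bsub>G\<^esub> (i::int) \<in> H"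
  using gen_H subgroup_H by (rule G.subgroup_int_pow_closed[rotated])

lemma el_in: "x \<in> B \<Longrightarrow> el x i \<in> H"
  unfolding el_def using gen_pow_in subgroup.m_closed[OF subgroup_H] by simp

text \<open>Dividing \<open>h\<close> by the power of \<open>(a, int k)\<close> with the same second
  component leaves an element of \<open>H\<close> in the base group.\<close>

lemma el_cases:
  assumes "h \<in> H" obtains x i where "x \<in> B" "h = el x i"
proof -
  obtain b m where h: "h = (b, m)" by fastforce
  then have "int k dvd m" using snd_dvd assms by blast
  then obtain i where i: "m = int k * i" by (rule dvdE)
  have hG: "h \<in> carrier G" using assms subgroup.mem_carrier[OF subgroup_H] by auto
  let ?u = "(a, int k) [^]\<^bsub>G\<^esub> i"
  obtain c where c: "c \<in> carrier A" "?u = (c, int k * i)" using pow_gen by blast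
  have "h \<otimes>\<^bsub>G\<^esub> inv\<^bsub>G\<^esub> ?u \<in> H"
    using assms gen_pow_in subgroup_H by (simp add: subgroup.m_closed subgroup.m_inv_closed)
  moreover have hu: "h \<otimes>\<^bsub>G\<^esub> inv\<^bsub>G\<^esub> ?u = (b \<otimes>\<^bsub>A\<^esub> inv\<^bsub>A\<^esub> c, 0)"
    using hG h i c by (simp add: div_G)
  ultimately have "b \<otimes>\<^bsub>A\<^esub> inv\<^bsub>A\<^esub> c \<in> B" by simp
  moreover have "h = el (b \<otimes>\<^bsub>A\<^esub> inv\<^bsub>A\<^esub> c) i"
    unfolding el_def hu[symmetric] using hG by (simp add: G.m_assoc)
  ultimately show thesis using that by blast
qed

text \<open>This shift is conjugation by a power of \<open>(a, int k)\<close>, which lies in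
  \<open>H\<close>.\<close>

lemma shift_B: "x \<in> B \<Longrightarrow> shift (int k * i) x \<in> B"
proof -
  assume x: "x \<in> B"
  obtain c where c: "c \<in> carrier A" "(a, int k) [^]\<^bsub>G\<^esub> i = (c, int k * i)" using pow_gen by blast
  then have "(c, int k * i) \<otimes>\<^bsub>G\<^esub> (x, 0) \<otimes>\<^bsub>G\<^esub> inv\<^bsub>G\<^esub> (c, int k * i) \<in> H"
    using x gen_pow_in[of i] subgroup_H by (simp add: subgroup.m_closed subgroup.m_inv_closed del: mult_G)
  then show ?thesis using conj_base[OF c(1) B_carrier[OF x]] by simp
qed

text \<open>Left multiplication by powers of \<open>(a, int k)\<close> reduces the second component
  modulo \<open>k\<close> without leaving the coset; what remains is the coset of the base component
  modulo \<open>B\<close>.\<close>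

lemma index_bij:
  assumes R: "R \<subseteq> carrier A" "bij_betw (\<lambda>x. B #>\<^bsub>A\<^esub> x) R (rcosets\<^bsub>A\<^esub> B)"
  shows "bij_betw (\<lambda>(r, j). H #>\<^bsub>G\<^esub> (r, j)) (R \<times> {0..<int k}) (rcosets\<^bsub>G\<^esub> H)"
  unfolding bij_betw_def
proof
  show "inj_on (\<lambda>(r, j). H #>\<^bsub>G\<^esub> (r, j)) (R \<times> {0..<int k})"
  proof (rule inj_onI, clarify)
    fix r j s i
    assume r: "r \<in> R" "s \<in> R" and ij: "j \<in> {0..<int k}" "i \<in> {0..<int k}"
      and eq: "H #>\<^bsub>G\<^esub> (r, j) = H #>\<^bsub>G\<^esub> (s, i)"
    have c: "r \<in> carrier A" "s \<in> carrier A" using r R(1) by auto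
    have mem: "(r \<otimes>\<^bsub>A\<^esub> shift (j - i) (inv\<^bsub>A\<^esub> s), j - i) \<in> H"
      using eq c G.rcos_eq_iff[OF subgroup_H, of "(r, j)" "(s, i)"] by (simp add: div_G)
    then have "int k dvd j - i" by (rule snd_dvd)
    then have "j = i" using ij zdvd_imp_le[of "int k" "\<bar>j - i\<bar>"] by (cases "j = i") auto
    then have "r \<otimes>\<^bsub>A\<^esub> inv\<^bsub>A\<^esub> s \<in> B" using mem by simp
    then have "B #>\<^bsub>A\<^esub> r = B #>\<^bsub>A\<^esub> s" using c A.rcos_eq_iff[OF subgroup_B] by blast
    then show "r = s \<and> j = i"
      using R(2) r \<open>j = i\<close> by (auto simp: bij_betw_def dest: inj_onD)
  qed
  show "(\<lambda>(r, j). H #>\<^bsub>G\<^esub> (r, j)) ` (R \<times> {0..<int k}) = rcosets\<^bsub>G\<^esub> H"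
  proof
    show "(\<lambda>(r, j). H #>\<^bsub>G\<^esub> (r, j)) ` (R \<times> {0..<int k}) \<subseteq> rcosets\<^bsub>G\<^esub> H"
      using R(1) by (auto simp: rcosets_image)
    show "rcosets\<^bsub>G\<^esub> H \<subseteq> (\<lambda>(r, j). H #>\<^bsub>G\<^esub> (r, j)) ` (R \<times> {0..<int k})"
    proof
      fix C assume "C \<in> rcosets\<^bsub>G\<^esub> H"
      then obtain b m where b: "b \<in> carrier A" "C = H #>\<^bsub>G\<^esub> (b, m)"
        by (auto simp: rcosets_image)
      \<comment> \<open>The power \<open>?q\<close> of \<open>(a, int k)\<close> takes
        \<open>(b, m)\<close> to \<open>(?b, m mod int k)\<close>, and \<open>?b\<close> is then
        replaced by its representative in \<open>R\<close>.\<close>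
      let ?q = "- (m div int k)"
      obtain c where c: "c \<in> carrier A" "(a, int k) [^]\<^bsub>G\<^esub> ?q = (c, int k * ?q)"
        using pow_gen by blast
      let ?b = "c \<otimes>\<^bsub>A\<^esub> shift (int k * ?q) b"
      have m: "int k * ?q + m = m mod int k" by (simp add: minus_mult_div_eq_mod)
      have bc: "?b \<in> carrier A" using b c by simp
      then have "B #>\<^bsub>A\<^esub> ?b \<in> (\<lambda>x. B #>\<^bsub>A\<^esub> x) ` R"
        using R(2) by (auto simp: bij_betw_def rcosets_image)
      then obtain r where r: "r \<in> R" "B #>\<^bsub>A\<^esub> ?b = B #>\<^bsub>A\<^esub> r" by blast
      then have rc: "r \<in> carrier A" using R(1) by auto
      have rH: "(?b \<otimes>\<^bsub>A\<^esub> inv\<^bsub>A\<^esub> r, 0) \<in> H"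
        using r(2) bc rc A.rcos_eq_iff[OF subgroup_B, of ?b r] by simp
      have "(c, int k * ?q) \<otimes>\<^bsub>G\<^esub> (b, m) \<in> carrier G" using b c by simp
      then have "(?b, m mod int k) \<otimes>\<^bsub>G\<^esub> inv\<^bsub>G\<^esub> (r, m mod int k) \<in> H"
        using rH bc rc by (simp add: div_G)
      then have 1: "H #>\<^bsub>G\<^esub> (?b, m mod int k) = H #>\<^bsub>G\<^esub> (r, m mod int k)"
        using G.rcos_eq_iff[OF subgroup_H] bc rc by simp
      have "(c, int k * ?q) \<in> H" using gen_pow_in[of ?q] c(2) by simp
      moreover have "(?b, m mod int k) \<otimes>\<^bsub>G\<^esub> inv\<^bsub>G\<^esub> (b, m) = (c, int k * ?q)"
      proof -
        have "(?b, m mod int k) = (c, int k * ?q) \<otimes>\<^bsub>G\<^esub> (b, m)" using m by simp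
        then show ?thesis using b c by (simp add: G.m_assoc del: mult_G)
      qed
      ultimately have "H #>\<^bsub>G\<^esub> (?b, m mod int k) = H #>\<^bsub>G\<^esub> (b, m)"
        using G.rcos_eq_iff[OF subgroup_H, of "(?b, m mod int k)" "(b, m)"] bc b(1) by simp
      then have "C = H #>\<^bsub>G\<^esub> (r, m mod int k)" using 1 b(2) by simp
      then show "C \<in> (\<lambda>(r, j). H #>\<^bsub>G\<^esub> (r, j)) ` (R \<times> {0..<int k})"
        using r(1) k_pos by (intro image_eqI[where x = "(r, m mod int k)"]) auto
    qed
  qed
qed

lemma index_eq: "card (rcosets\<^bsub>G\<^esub> H) = card (rcosets\<^bsub>A\<^esub> B) * k"
  and finite_index_base: "finite (rcosets\<^bsub>G\<^esub> H) \<Longrightarrow> finite (rcosets\<^bsub>A\<^esub> B)"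
proof -
  obtain R where R: "R \<subseteq> carrier A" "bij_betw (\<lambda>x. B #>\<^bsub>A\<^esub> x) R (rcosets\<^bsub>A\<^esub> B)"
    by (rule A.obtain_transversal)
  note bij = index_bij[OF R]
  show "card (rcosets\<^bsub>G\<^esub> H) = card (rcosets\<^bsub>A\<^esub> B) * k"
    using bij_betw_same_card[OF bij] bij_betw_same_card[OF R(2)] by (simp add: card_cartesian_product)
  assume "finite (rcosets\<^bsub>G\<^esub> H)"
  then have "finite (R \<times> {0..<int k})" using bij_betw_finite[OF bij] by simp
  then have "finite R" using k_pos by (auto simp: finite_cartesian_product_iff)
  then show "finite (rcosets\<^bsub>A\<^esub> B)" using bij_betw_finite[OF R(2)] by simp
qed

text \<open>A version of the division algorithm: in each residue class modulo the rank \<open>k n\<close> take an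
  element of \<open>B\<close> with top degree in that class and minimal width. Subtracting a shifted multiple
  of it from an element of \<open>B\<close> removes the top coordinate without extending the support below.\<close>

lemma generators:
  obtains S where "finite S" "S \<subseteq> H" "generate G S = H" "card S \<le> k * n + 1"
proof -
  define N where "N = int k * int n"
  have N: "N > 0" using k_pos n_pos by (simp add: N_def)
  \<comment> \<open>Shifting by multiples of \<open>k\<close> moves coordinates by multiples of
    \<open>N\<close>, so it preserves the class \<open>r\<close> of the top coordinate
    \<open>t\<close> and the width \<open>w\<close>.\<close>
  define P where "P r w c \<longleftrightarrow> c \<in> B \<and> (\<exists>t. t mod N = r \<and> coord c t \<noteq> 0 \<and> supp c \<subseteq> {t - int w..t})" for r w c
  define I where "I = {r \<in> {0..<N}. \<exists>w c. P r w c}"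
  define \<omega> where "\<omega> r = (LEAST w. \<exists>c. P r w c)" for r
  define g where "g r = (SOME c. P r (\<omega> r) c)" for r
  have g: "P r (\<omega> r) (g r)" if "r \<in> I" for r
  proof -
    have "\<exists>w c. P r w c" using that by (simp add: I_def)
    then have "\<exists>c. P r (\<omega> r) c" unfolding \<omega>_def by (rule LeastI_ex)
    then show ?thesis unfolding g_def by (rule someI_ex)
  qed
  define S where "S = insert (a, int k) ((\<lambda>r. (g r, 0)) ` I)"
  have I: "finite I" "card I \<le> k * n"
  proof -
    have sub: "I \<subseteq> {0..<N}" by (auto simp: I_def)
    then show "finite I" by (rule finite_subset) simp
    show "card I \<le> k * n" using card_mono[OF _ sub] by (simp add: N_def nat_mult_distrib)
  qed
  have SH: "S \<subseteq> H" using g gen_H by (auto simp: S_def P_def)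
  have Sc: "S \<subseteq> carrier G" using SH subgroup.subset[OF subgroup_H] by blast
  let ?D = "generate G S"
  have D: "subgroup ?D G" by (rule G.generate_is_subgroup[OF Sc])
  have uD: "(a, int k) [^]\<^bsub>G\<^esub> (i::int) \<in> ?D" for i
    using G.subgroup_int_pow_closed[OF D] generate.incl[of "(a, int k)" S G] by (simp add: S_def)
  have gD: "(shift (int k * i) (g r), 0) \<in> ?D" if "r \<in> I" for r i
  proof -
    have gc: "g r \<in> carrier A" using g[OF that] B_carrier by (simp add: P_def)
    obtain c where c: "c \<in> carrier A" "(a, int k) [^]\<^bsub>G\<^esub> i = (c, int k * i)" using pow_gen by blast
    have "(g r, 0) \<in> ?D" using that by (intro generate.incl) (simp add: S_def)
    then have "(c, int k * i) \<otimes>\<^bsub>G\<^esub> (g r, 0) \<otimes>\<^bsub>G\<^esub> inv\<^bsub>G\<^esub> (c, int k * i) \<in> ?D"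
      using uD[of i] c D by (simp add: subgroup.m_closed subgroup.m_inv_closed del: mult_G)
    then show ?thesis using conj_base[OF c(1) gc] by simp
  qed
  \<comment> \<open>Induction on the length of an interval containing the support.\<close>
  have "(c, 0) \<in> ?D" if "c \<in> B" "supp c \<subseteq> {l..<l + int w}" for c l w
    using that
  proof (induction w arbitrary: c)
    case 0
    then have "c = \<one>\<^bsub>A\<^esub>" using supp_empty[OF B_carrier] by simp
    then show ?case using subgroup.one_closed[OF D] by (simp add: one_G)
  next
    case (Suc w)
    define t where "t = l + int w"
    show ?case
    proof (cases "coord c t = 0")
      case True
      have "supp c \<subseteq> {l..<l + int w}"
      proof
        fix q assume q: "q \<in> supp c"
        then have "q \<noteq> t" using True by (auto simp: supp_def)
        then show "q \<in> {l..<l + int w}" using q Suc.prems(2) by (auto simp: t_def)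
      qed
      then show ?thesis using Suc by blast
    next
      case False
      define r where "r = t mod N"
      have "P r w c"
        unfolding P_def using Suc.prems False by (auto simp: r_def t_def intro!: exI[of _ "l + int w"])
      then have rI: "r \<in> I" using N by (auto simp: I_def r_def)
      \<comment> \<open>Minimal width keeps the support of the shifted generator \<open>f\<close>
        above \<open>l\<close>.\<close>
      have wle: "\<omega> r \<le> w" unfolding \<omega>_def using \<open>P r w c\<close> by (intro Least_le) blast
      obtain t' where gr: "g r \<in> B" "t' mod N = r" "coord (g r) t' \<noteq> 0" "supp (g r) \<subseteq> {t' - int (\<omega> r)..t'}"
        using g[OF rI] by (auto simp: P_def)
      have "N dvd t - t'" using gr(2) r_def by (metis mod_eq_dvd_iff)
      then obtain i where i: "t - t' = N * i" by (elim dvdE)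
      define f where "f = shift (int k * i) (g r)"
      have fB: "f \<in> B" unfolding f_def using gr(1) by (rule shift_B)
      have fD: "(f, 0) \<in> ?D" unfolding f_def by (rule gD[OF rI])
      have tt: "t' = t - int k * i * int n" using i by (simp add: N_def algebra_simps)
      have ft: "coord f t \<noteq> 0" using gr(3) by (simp add: f_def coord_shift tt)
      have fs: "supp f \<subseteq> {l..t}"
      proof
        fix q assume "q \<in> supp f"
        then have "q - int k * i * int n \<in> supp (g r)" by (simp add: f_def supp_def coord_shift)
        then show "q \<in> {l..t}" using gr(4) wle by (auto simp: tt t_def)
      qed
      have cc: "c \<in> carrier A" "f \<in> carrier A" using Suc.prems(1) fB B_carrier by auto
      obtain m :: nat where m: "coord (c \<otimes>\<^bsub>A\<^esub> f [^]\<^bsub>A\<^esub> m) t = 0"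
        using cancel_coord[OF cc ft] by blast
      let ?c = "c \<otimes>\<^bsub>A\<^esub> f [^]\<^bsub>A\<^esub> m"
      have fmB: "f [^]\<^bsub>A\<^esub> m \<in> B"
        using fB by (metis A.subgroup_int_pow_closed[OF subgroup_B] int_pow_int)
      have cB: "?c \<in> B"
        using Suc.prems(1) fmB subgroup.m_closed[OF subgroup_B] by blast
      have "supp ?c \<subseteq> {l..<l + int w}"
      proof
        fix q assume q: "q \<in> supp ?c"
        then have "q \<noteq> t" using m by (auto simp: supp_def)
        moreover have "q \<in> supp c \<union> supp f" using q supp_mult supp_pow[OF cc(2)] by blast
        ultimately show "q \<in> {l..<l + int w}" using fs Suc.prems(2) by (auto simp: t_def)
      qed
      then have "(?c, 0) \<in> ?D" using cB Suc.IH by blast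
      moreover have "(f [^]\<^bsub>A\<^esub> m, 0) \<in> ?D"
        using G.subgroup_int_pow_closed[OF D fD, of "int m"] cc(2) by (simp add: int_pow_int pow_base)
      ultimately have "(?c, 0) \<otimes>\<^bsub>G\<^esub> inv\<^bsub>G\<^esub> (f [^]\<^bsub>A\<^esub> m, 0) \<in> ?D"
        using D by (simp add: subgroup.m_closed subgroup.m_inv_closed)
      also have "(?c, 0) \<otimes>\<^bsub>G\<^esub> inv\<^bsub>G\<^esub> (f [^]\<^bsub>A\<^esub> m, 0) = (c, 0)"
        using cc by (simp add: div_G A.m_assoc)
      finally show ?thesis .
    qed
  qed
  note red = this
  have BD: "(c, 0) \<in> ?D" if c: "c \<in> B" for c
  proof -
    obtain l where l: "l \<ge> 0" "supp c \<subseteq> {-l..<l}"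
      using finite_int_bounds[OF finite_supp[OF B_carrier[OF c]]] by blast
    then show ?thesis using red[OF c, of "-l" "nat (2 * l)"] by simp
  qed
  have "?D = H"
  proof
    show "?D \<subseteq> H" using SH subgroup_H by (rule G.generate_subgroup_incl)
    show "H \<subseteq> ?D"
    proof
      fix h assume "h \<in> H"
      then obtain x i where "x \<in> B" "h = el x i" by (rule el_cases)
      then show "h \<in> ?D" unfolding el_def using BD uD subgroup.m_closed[OF D] by blast
    qed
  qed
  moreover have "card S \<le> k * n + 1"
  proof -
    have "card S \<le> card ((\<lambda>r. (g r, 0::int)) ` I) + 1"
      unfolding S_def using I(1) by (simp add: card_insert_if)
    also have "\<dots> \<le> card I + 1" using I(1) by (simp add: card_image_le)
    finally show ?thesis using I(2) by simp
  qed
  ultimately show thesis using that[of S] I(1) SH by (simp add: S_def)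
qed

end

section \<open>Lower bound for the number of generators\<close>

context lamp_subgroup
begin

text \<open>Multiplication by \<open>t\<^sup>k - 1\<close>, in multiplicative notation.\<close>

definition \<sigma> :: "(int \<Rightarrow> nat \<Rightarrow> int) \<Rightarrow> int \<Rightarrow> nat \<Rightarrow> int" where
  "\<sigma> x = shift (int k) x \<otimes>\<^bsub>A\<^esub> inv\<^bsub>A\<^esub> x"

lemma \<sigma>_mult:
  "x \<in> carrier A \<Longrightarrow> y \<in> carrier A \<Longrightarrow> \<sigma> (x \<otimes>\<^bsub>A\<^esub> y) = \<sigma> x \<otimes>\<^bsub>A\<^esub> \<sigma> y"
  by (simp add: \<sigma>_def shift_mult A.inv_mult_group A.m_ac)

lemma \<sigma>_hom: "\<sigma> \<in> hom A A"
  by (rule homI) (simp_all add: \<sigma>_mult, simp add: \<sigma>_def)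

lemma \<sigma>_shift: "x \<in> carrier A \<Longrightarrow> shift i (\<sigma> x) = \<sigma> (shift i x)"
  by (simp add: \<sigma>_def shift_mult shift_inv add.commute)

text \<open>Outside the window of length \<open>N = k n\<close> the coordinates of \<open>c\<close>
  satisfy \<open>coord c (q - N) = coord c q\<close>. For the top coordinate \<open>t\<close> this
  forces \<open>t + N\<close> into the window, so \<open>t < 0\<close>; for the bottom one
  \<open>l\<close> it forces \<open>l \<ge> 0\<close>.\<close>

lemma \<sigma>_supported:
  assumes c: "c \<in> carrier A" and s: "supp (\<sigma> c) \<subseteq> {0..<int k * int n}"
  shows "c = \<one>\<^bsub>A\<^esub>"
proof (rule supp_empty[OF c], rule ccontr)
  assume ne: "supp c \<noteq> {}"
  define N where "N = int k * int n"
  have N: "N > 0" using k_pos n_pos by (simp add: N_def)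
  have fin: "finite (supp c)" by (rule finite_supp[OF c])
  have eq: "coord c (q - N) = coord c q" if "q \<notin> {0..<N}" for q
  proof -
    have "coord (\<sigma> c) q = 0" using that s by (auto simp: supp_def N_def)
    then have "(coord c (q - N) - coord c q) mod int p = 0"
      using c by (simp add: \<sigma>_def coord_mult coord_shift coord_inv N_def mod_add_right_eq)
    then have "coord c (q - N) mod int p = coord c q mod int p"
      by (simp add: mod_eq_dvd_iff mod_0_imp_dvd)
    then show ?thesis using coord_mod[OF c] by simp
  qed
  define t where "t = Max (supp c)"
  define l where "l = Min (supp c)"
  have t: "t \<in> supp c" "\<And>q. q \<in> supp c \<Longrightarrow> q \<le> t"
    using fin ne by (auto simp: t_def)
  have l: "l \<in> supp c" "\<And>q. q \<in> supp c \<Longrightarrow> l \<le> q"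
    using fin ne by (auto simp: l_def)
  have "t + N \<notin> supp c" using t(2)[of "t + N"] N by auto
  then have "t + N \<in> {0..<N}" using eq[of "t + N"] t(1) by (auto simp: supp_def)
  moreover have "l - N \<notin> supp c" using l(2)[of "l - N"] N by auto
  then have "l \<in> {0..<N}" using eq[of l] l(1) by (auto simp: supp_def)
  ultimately show False using t(2)[OF l(1)] by simp
qed

text \<open>A kernel element has an image with empty support, so \<open>\<sigma>_supported\<close>
  applies to it.\<close>

lemma \<sigma>_inj: "inj_on \<sigma> (carrier A)"
proof (rule inj_onI)
  fix x y assume xy: "x \<in> carrier A" "y \<in> carrier A" "\<sigma> x = \<sigma> y"
  have sc: "\<sigma> z \<in> carrier A" if "z \<in> carrier A" for z
    using that by (simp add: \<sigma>_def)
  have "\<sigma> (x \<otimes>\<^bsub>A\<^esub> inv\<^bsub>A\<^esub> y) \<otimes>\<^bsub>A\<^esub> \<sigma> y = \<sigma> y"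
    using xy by (simp add: A.m_assoc flip: \<sigma>_mult)
  then have "\<sigma> (x \<otimes>\<^bsub>A\<^esub> inv\<^bsub>A\<^esub> y) = \<one>\<^bsub>A\<^esub>"
    using xy sc by simp
  then have "x \<otimes>\<^bsub>A\<^esub> inv\<^bsub>A\<^esub> y = \<one>\<^bsub>A\<^esub>"
    using xy by (intro \<sigma>_supported) auto
  then show "x = y" using xy A.inv_equality[of x "inv\<^bsub>A\<^esub> y"] by simp
qed

lemma \<sigma>_B: "x \<in> B \<Longrightarrow> \<sigma> x \<in> B"
  using shift_B[of x 1] subgroup_B by (simp add: \<sigma>_def subgroup.m_closed subgroup.m_inv_closed del: mem_base_part)

lemma subgroup_\<sigma>B: "subgroup (\<sigma> ` B) A"
proof -
  interpret \<sigma>: group_hom A A \<sigma>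
    using \<sigma>_hom by (intro group_hom.intro group_hom_axioms.intro) (auto intro: A.is_group)
  show ?thesis by (rule \<sigma>.subgroup_img_is_subgroup[OF subgroup_B])
qed

lemma shift_\<sigma>B: "y \<in> \<sigma> ` B \<Longrightarrow> shift (int k * i) y \<in> \<sigma> ` B"
  using \<sigma>_shift B_carrier shift_B by (auto simp del: mem_base_part)

text \<open>Telescoping: \<open>t ^ (k m) - 1\<close> is a multiple of \<open>t ^ k - 1\<close>,
  with a quotient that maps \<open>B\<close> to itself.\<close>

lemma shift_diff_in: "y \<in> B \<Longrightarrow> shift (int k * i) y \<otimes>\<^bsub>A\<^esub> inv\<^bsub>A\<^esub> y \<in> \<sigma> ` B"
proof -
  assume y: "y \<in> B"
  have nat: "shift (int k * int m) z \<otimes>\<^bsub>A\<^esub> inv\<^bsub>A\<^esub> z \<in> \<sigma> ` B" if z: "z \<in> B" for m z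
  proof (induction m)
    case 0
    then show ?case using B_carrier[OF z] subgroup.one_closed[OF subgroup_\<sigma>B] by simp
  next
    case (Suc m)
    let ?z = "shift (int k * int m) z"
    have zB: "?z \<in> B" using z by (rule shift_B)
    then have "\<sigma> ?z \<otimes>\<^bsub>A\<^esub> (?z \<otimes>\<^bsub>A\<^esub> inv\<^bsub>A\<^esub> z) \<in> \<sigma> ` B"
      using Suc subgroup.m_closed[OF subgroup_\<sigma>B] by blast
    moreover have "\<sigma> ?z \<otimes>\<^bsub>A\<^esub> (?z \<otimes>\<^bsub>A\<^esub> inv\<^bsub>A\<^esub> z) = shift (int k * int (Suc m)) z \<otimes>\<^bsub>A\<^esub> inv\<^bsub>A\<^esub> z"
    proof -
      have c: "z \<in> carrier A" "?z \<in> carrier A" using B_carrier[OF z] by simp_all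
      have "inv\<^bsub>A\<^esub> ?z \<otimes>\<^bsub>A\<^esub> (?z \<otimes>\<^bsub>A\<^esub> inv\<^bsub>A\<^esub> z) = inv\<^bsub>A\<^esub> z"
        using c by (simp flip: A.m_assoc)
      then show ?thesis using c by (simp add: \<sigma>_def A.m_assoc algebra_simps)
    qed
    ultimately show ?case by simp
  qed
  show ?thesis
  proof (cases i rule: int_cases2)
    case (nonneg m)
    then show ?thesis using nat[OF y] by simp
  next
    case (nonpos m)
    \<comment> \<open>For a negative exponent the roles are exchanged: \<open>y\<close> is a
      nonnegative shift of \<open>?z\<close>, and the difference is inverted.\<close>
    let ?z = "shift (int k * i) y"
    have zB: "?z \<in> B" using y by (rule shift_B)
    have "inv\<^bsub>A\<^esub> (shift (int k * int m) ?z \<otimes>\<^bsub>A\<^esub> inv\<^bsub>A\<^esub> ?z) \<in> \<sigma> ` B"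
      using nat[OF zB] subgroup.m_inv_closed[OF subgroup_\<sigma>B] by blast
    then show ?thesis
      using B_carrier[OF y] B_carrier[OF zB] nonpos by (simp add: A.inv_mult_group)
  qed
qed

text \<open>\<open>L\<close> contains the commutators and the \<open>p\<close>-th powers of \<open>H\<close>, and \<open>H / L\<close> is elementary
  abelian of order \<open>p ^ (k n + 1)\<close>.\<close>

definition L :: "((int \<Rightarrow> nat \<Rightarrow> int) \<times> int) set" where
  "L = {el x (int p * i) | x i. x \<in> \<sigma> ` B}"

lemma LI: "x \<in> \<sigma> ` B \<Longrightarrow> int p dvd i \<Longrightarrow> el x i \<in> L"
  by (auto simp: L_def)

lemma \<sigma>B_carrier: "x \<in> \<sigma> ` B \<Longrightarrow> x \<in> carrier A"
  using subgroup.mem_carrier[OF subgroup_\<sigma>B] .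

lemma L_subset: "L \<subseteq> H"
  using \<sigma>_B el_in by (auto simp: L_def simp del: mem_base_part)

lemma subgroup_L: "subgroup L G"
proof
  show "L \<subseteq> carrier G" using L_subset subgroup.subset[OF subgroup_H] by blast
next
  fix g h assume "g \<in> L" "h \<in> L"
  then obtain x i y j where xy: "x \<in> \<sigma> ` B" "y \<in> \<sigma> ` B" "g = el x (int p * i)" "h = el y (int p * j)"
    unfolding L_def by blast
  have "x \<otimes>\<^bsub>A\<^esub> shift (int k * (int p * i)) y \<in> \<sigma> ` B"
    using xy(1) shift_\<sigma>B[OF xy(2)] subgroup.m_closed[OF subgroup_\<sigma>B] by blast
  then show "g \<otimes>\<^bsub>G\<^esub> h \<in> L"
    using xy \<sigma>B_carrier LI by (simp add: el_mult)
next
  show "\<one>\<^bsub>G\<^esub> \<in> L" using LI[of "\<one>\<^bsub>A\<^esub>" 0] subgroup.one_closed[OF subgroup_\<sigma>B] by (simp add: el_one)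
next
  fix g assume "g \<in> L"
  then obtain x i where x: "x \<in> \<sigma> ` B" "g = el x (int p * i)" unfolding L_def by blast
  have "shift (int k * (- (int p * i))) (inv\<^bsub>A\<^esub> x) \<in> \<sigma> ` B"
    by (intro shift_\<sigma>B subgroup.m_inv_closed[OF subgroup_\<sigma>B] x)
  then show "inv\<^bsub>G\<^esub> g \<in> L"
    using x \<sigma>B_carrier LI by (simp add: el_inv)
qed

text \<open>The exponents of \<open>(a, int k)\<close> cancel, and the base component is a quotient
  of two elements of the form treated in \<open>shift_diff_in\<close>.\<close>

lemma commutator_in_L:
  assumes "g \<in> H" "h \<in> H"
  shows "(g \<otimes>\<^bsub>G\<^esub> h) \<otimes>\<^bsub>G\<^esub> inv\<^bsub>G\<^esub> (h \<otimes>\<^bsub>G\<^esub> g) \<in> L"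
proof -
  obtain x i y j where x: "x \<in> B" "g = el x i" and y: "y \<in> B" "h = el y j"
    using assms el_cases by metis
  note c = B_carrier[OF x(1)] B_carrier[OF y(1)]
  let ?x = "shift (int k * j) x" and ?y = "shift (int k * i) y"
  have "(g \<otimes>\<^bsub>G\<^esub> h) \<otimes>\<^bsub>G\<^esub> inv\<^bsub>G\<^esub> (h \<otimes>\<^bsub>G\<^esub> g) = el ((x \<otimes>\<^bsub>A\<^esub> ?y) \<otimes>\<^bsub>A\<^esub> inv\<^bsub>A\<^esub> (y \<otimes>\<^bsub>A\<^esub> ?x)) 0"
    using c by (simp add: x(2) y(2) el_mult el_div)
  also have "(x \<otimes>\<^bsub>A\<^esub> ?y) \<otimes>\<^bsub>A\<^esub> inv\<^bsub>A\<^esub> (y \<otimes>\<^bsub>A\<^esub> ?x) = (?y \<otimes>\<^bsub>A\<^esub> inv\<^bsub>A\<^esub> y) \<otimes>\<^bsub>A\<^esub> inv\<^bsub>A\<^esub> (?x \<otimes>\<^bsub>A\<^esub> inv\<^bsub>A\<^esub> x)"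
    using c by (simp add: A.inv_mult_group A.m_ac)
  finally show ?thesis
    using LI[OF subgroup.m_closed[OF subgroup_\<sigma>B shift_diff_in[OF y(1)]
        subgroup.m_inv_closed[OF subgroup_\<sigma>B shift_diff_in[OF x(1)]]], of 0] by simp
qed

text \<open>\<open>H / L\<close> is abelian of exponent \<open>p\<close>, so \<open>card S\<close>
  generators give at most \<open>p ^ card S\<close> classes, while \<open>p ^ (k n + 1)\<close>
  distinct ones are exhibited. The finite index of \<open>B\<close> enters through
  \<open>endomorphism_index\<close>, which transfers a count modulo \<open>\<sigma> A\<close> to one
  modulo \<open>\<sigma> B\<close>.\<close>

lemma le_card_generators:
  assumes fin: "finite (rcosets\<^bsub>A\<^esub> B)" and S: "finite S" "S \<subseteq> H" "generate G S = H"
  shows "k * n + 1 \<le> card S"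
proof -
  \<comment> \<open>By \<open>\<sigma>_supported\<close> distinct elements of this window are
    incongruent modulo \<open>\<sigma> A\<close>.\<close>
  define V where "V = {v \<in> carrier A. supp v \<subseteq> {0..<int k * int n}}"
  have V: "finite V" "card V = p ^ (k * n)"
    by (simp_all add: V_def card_supported nat_mult_distrib)
  have Vinj: "v = w" if "v \<in> V" "w \<in> V" and vw: "v \<otimes>\<^bsub>A\<^esub> inv\<^bsub>A\<^esub> w \<in> \<sigma> ` carrier A" for v w
  proof -
    have c: "v \<in> carrier A" "w \<in> carrier A" using that by (auto simp: V_def)
    obtain z where z: "z \<in> carrier A" "v \<otimes>\<^bsub>A\<^esub> inv\<^bsub>A\<^esub> w = \<sigma> z" using vw by blast
    have "supp (v \<otimes>\<^bsub>A\<^esub> inv\<^bsub>A\<^esub> w) \<subseteq> supp v \<union> supp w"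
      using supp_mult[of v "inv\<^bsub>A\<^esub> w"] supp_inv[OF c(2)] by blast
    also have "\<dots> \<subseteq> {0..<int k * int n}" using that(1,2) by (simp add: V_def)
    finally have "supp (\<sigma> z) \<subseteq> {0..<int k * int n}" unfolding z(2) .
    then have "z = \<one>\<^bsub>A\<^esub>" by (rule \<sigma>_supported[OF z(1)])
    then have "v \<otimes>\<^bsub>A\<^esub> inv\<^bsub>A\<^esub> w = \<one>\<^bsub>A\<^esub>" using z(2) by (simp add: \<sigma>_def)
    then show ?thesis using c A.inv_equality[of v "inv\<^bsub>A\<^esub> w"] by simp
  qed
  have "\<sigma> ` B \<subseteq> B" using \<sigma>_B by blast
  then obtain W where W: "W \<subseteq> B" "finite W" "card W = p ^ (k * n)"
      "\<And>v w. v \<in> W \<Longrightarrow> w \<in> W \<Longrightarrow> v \<otimes>\<^bsub>A\<^esub> inv\<^bsub>A\<^esub> w \<in> \<sigma> ` B \<Longrightarrow> v = w"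
  proof (rule A.endomorphism_index[OF \<sigma>_hom \<sigma>_inj subgroup_B _ fin V(1) _ Vinj])
    show "V \<subseteq> carrier A" by (auto simp: V_def)
  qed (use V(2) in simp_all)
  \<comment> \<open>The exponent of \<open>(a, int k)\<close> modulo \<open>p\<close> contributes
    the additional factor \<open>p\<close>.\<close>
  define U where "U = (\<lambda>(w, j). el w j) ` (W \<times> {0..<int p})"
  have Wc: "w \<in> carrier A" if "w \<in> W" for w using that W(1) B_carrier by blast
  have "inj_on (\<lambda>(w, j). el w j) (W \<times> {0..<int p})"
  proof (rule inj_onI, clarify)
    fix v i w j assume "v \<in> W" "w \<in> W" "el v i = el w j"
    then show "v = w \<and> i = j" using el_inject Wc by blast
  qed
  then have cardU: "card U = p ^ (k * n) * p"
    by (simp add: U_def card_image card_cartesian_product W(3))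
  have UH: "U \<subseteq> H" using W(1) el_in by (auto simp: U_def simp del: mem_base_part)
  have Uinj: "g = h" if gh: "g \<in> U" "h \<in> U" "g \<otimes>\<^bsub>G\<^esub> inv\<^bsub>G\<^esub> h \<in> L" for g h
  proof -
    obtain v i where v: "v \<in> W" "i \<in> {0..<int p}" "g = el v i" using gh(1) by (auto simp: U_def)
    obtain w j where w: "w \<in> W" "j \<in> {0..<int p}" "h = el w j" using gh(2) by (auto simp: U_def)
    have "el (v \<otimes>\<^bsub>A\<^esub> shift (int k * (i - j)) (inv\<^bsub>A\<^esub> w)) (i - j) \<in> L"
      using gh(3) v w Wc by (simp add: el_div)
    then obtain x q where x: "x \<in> \<sigma> ` B"
        "el (v \<otimes>\<^bsub>A\<^esub> shift (int k * (i - j)) (inv\<^bsub>A\<^esub> w)) (i - j) = el x (int p * q)"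
      unfolding L_def by blast
    then have e: "v \<otimes>\<^bsub>A\<^esub> shift (int k * (i - j)) (inv\<^bsub>A\<^esub> w) = x" "i - j = int p * q"
      using el_inject[OF x(2)] v(1) w(1) Wc \<sigma>B_carrier by auto
    have "int p dvd i - j" using e(2) by simp
    then have "i = j" using v(2) w(2) zdvd_imp_le[of "int p" "\<bar>i - j\<bar>"] by (cases "i = j") auto
    then have "v = w" using e(1) x(1) W(4)[OF v(1) w(1)] by simp
    then show ?thesis using \<open>i = j\<close> v w by simp
  qed
  let ?H = "G\<lparr>carrier := H\<rparr>"
  interpret H: group ?H by (rule G.subgroup_imp_group[OF subgroup_H])
  have inv_eq: "inv\<^bsub>?H\<^esub> h = inv\<^bsub>G\<^esub> h" if "h \<in> H" for h
    using G.m_inv_consistent[OF subgroup_H that] .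
  have HG: "h \<in> carrier G" if "h \<in> H" for h using that subgroup.mem_carrier[OF subgroup_H] by blast
  have "card U \<le> p ^ card S"
  proof -
    have "finite U \<and> card U \<le> p ^ card S"
    proof (rule H.card_le_exponent_quotient[of S L])
      show "generate ?H S = carrier ?H" using G.generate_consistent[OF S(2) subgroup_H] S(3) by simp
      show "subgroup L ?H" using G.subgroup_incl[OF subgroup_L subgroup_H L_subset] .
    next
      fix x y assume "x \<in> carrier ?H" "y \<in> carrier ?H"
      then show "x \<otimes>\<^bsub>?H\<^esub> y \<otimes>\<^bsub>?H\<^esub> inv\<^bsub>?H\<^esub> (y \<otimes>\<^bsub>?H\<^esub> x) \<in> L"
        using commutator_in_L[of x y] subgroup.m_closed[OF subgroup_H] by (simp add: inv_eq)
    next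
      fix g assume "g \<in> carrier ?H"
      then have "g \<in> H" by simp
      then obtain x i where x: "x \<in> B" "g = el x i" by (rule el_cases)
      have xc: "x \<in> carrier A" by (rule B_carrier[OF x(1)])
      have pc: "h [^]\<^bsub>?H\<^esub> p = h [^]\<^bsub>G\<^esub> p" for h
        using G.nat_pow_consistent[of h p H] by (rule sym)
      \<comment> \<open>The two factors of \<open>el x i\<close> have easy \<open>p\<close>-th
        powers: the identity, and a power of \<open>(a, int k)\<close> with exponent divisible by
        \<open>p\<close>.\<close>
      have "(x, 0) [^]\<^bsub>G\<^esub> p \<in> L"
        using subgroup.one_closed[OF subgroup_L] xc by (simp add: pow_base pow_p one_G)
      moreover have "((a, int k) [^]\<^bsub>G\<^esub> i) [^]\<^bsub>G\<^esub> p \<in> L"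
      proof -
        have "((a, int k) [^]\<^bsub>G\<^esub> i) [^]\<^bsub>G\<^esub> p = (a, int k) [^]\<^bsub>G\<^esub> (i * int p)"
          by (simp add: int_pow_int[symmetric] G.int_pow_pow)
        also have "\<dots> = el \<one>\<^bsub>A\<^esub> (i * int p)" by (simp add: el_def one_G[symmetric])
        also have "\<dots> \<in> L" using subgroup.one_closed[OF subgroup_\<sigma>B] by (intro LI) auto
        finally show ?thesis .
      qed
      ultimately show "\<exists>y\<in>carrier ?H. \<exists>z\<in>carrier ?H. g = y \<otimes>\<^bsub>?H\<^esub> z \<and> y [^]\<^bsub>?H\<^esub> p \<in> L \<and> z [^]\<^bsub>?H\<^esub> p \<in> L"
        using x(1) gen_pow_in[of i] unfolding pc x(2) el_def
        by (intro bexI[of _ "(x, 0)"] bexI[of _ "(a, int k) [^]\<^bsub>G\<^esub> i"]) auto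
    next
      fix v w assume vw: "v \<in> U" "w \<in> U" "v \<otimes>\<^bsub>?H\<^esub> inv\<^bsub>?H\<^esub> w \<in> L"
      then have "w \<in> H" using UH by blast
      then show "v = w" using Uinj[OF vw(1,2)] vw(3) by (simp add: inv_eq)
    qed (use S UH p_pos in auto)
    then show ?thesis by simp
  qed
  then have "p ^ (k * n + 1) \<le> p ^ card S" using cardU by (simp add: mult.commute)
  then show ?thesis using p_gt_1 power_le_imp_le_exp by blast
qed

lemma min_generators_eq:
  assumes "finite (rcosets\<^bsub>G\<^esub> H)"
  shows "min_generators G H = enat (k * n + 1)"
proof (rule antisym)
  obtain S where S: "finite S" "S \<subseteq> H" "generate G S = H" "card S \<le> k * n + 1"
    by (rule generators)
  have "min_generators G H \<le> enat (card S)"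
    unfolding min_generators_def using S by (intro Inf_lower) blast
  also have "\<dots> \<le> enat (k * n + 1)" using S(4) by simp
  finally show "min_generators G H \<le> enat (k * n + 1)" .
  show "enat (k * n + 1) \<le> min_generators G H"
    unfolding min_generators_def
    by (intro Inf_greatest) (use le_card_generators[OF finite_index_base[OF assms]] in auto)
qed

end

section \<open>The rank ratio of a single subgroup\<close>

context lamp
begin

lemma card_rcosets_pos: "finite (rcosets\<^bsub>A\<^esub> C) \<Longrightarrow> card (rcosets\<^bsub>A\<^esub> C) > 0"
  using A.one_closed by (auto simp: card_gt_0_iff rcosets_image)

text \<open>The numerator is \<open>k n\<close> and the index is \<open>k\<close> times that of the
  base part, so \<open>k\<close> cancels. This frees the later limits from \<open>k\<close>, which
  varies along a chain.\<close>

lemma rank_ratio: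
  assumes H: "subgroup H G" and fin: "finite (rcosets\<^bsub>G\<^esub> H)"
  shows "(ereal_of_enat (min_generators G H) - 1) / ereal (real (subgroup_index G H))
    = ereal (real n / real (card (rcosets\<^bsub>A\<^esub> (base_part H))))"
    and "finite (rcosets\<^bsub>A\<^esub> (base_part H))"
    and "\<exists>k>0. \<forall>x\<in>base_part H. shift (int k) x \<in> base_part H \<and> shift (- int k) x \<in> base_part H"
proof -
  obtain a k where k: "k > 0" "(a, int k) \<in> H" "\<And>b m. (b, m) \<in> H \<Longrightarrow> int k dvd m"
    by (rule finite_index_obtain_generator[OF H fin]) (rule that)
  interpret lamp_subgroup p n H a k
    by (intro lamp_subgroup.intro lamp_subgroup_axioms.intro) (fact lamp_axioms H k)+
  have "ereal_of_enat (min_generators G H) - 1 = ereal (real (k * n))"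
    by (simp add: min_generators_eq[OF fin] one_ereal_def)
  then show "(ereal_of_enat (min_generators G H) - 1) / ereal (real (subgroup_index G H))
    = ereal (real n / real (card (rcosets\<^bsub>A\<^esub> (base_part H))))"
    using k(1) card_rcosets_pos[OF finite_index_base[OF fin]]
    by (simp add: subgroup_index_def index_eq)
  show "finite (rcosets\<^bsub>A\<^esub> (base_part H))" by (rule finite_index_base[OF fin])
  show "\<exists>k>0. \<forall>x\<in>base_part H. shift (int k) x \<in> base_part H \<and> shift (- int k) x \<in> base_part H"
    using k(1) shift_B[of _ 1] shift_B[of _ "-1"] by (auto simp del: mem_base_part)
qed

section \<open>Cores\<close>

text \<open>Pigeonhole: \<open>A\<close> is infinite, but the list of cosets of the first
  \<open>k\<close> shifts takes finitely many values. A quotient of two elements with equal lists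
  has those shifts in \<open>C\<close>, and invariance under the shift by \<open>k\<close> yields
  the others.\<close>

lemma shift_invariant_core_nontrivial:
  assumes C: "subgroup C A" "finite (rcosets\<^bsub>A\<^esub> C)" and k: "k > 0"
    and inv: "\<And>x. x \<in> C \<Longrightarrow> shift (int k) x \<in> C" "\<And>x. x \<in> C \<Longrightarrow> shift (- int k) x \<in> C"
  obtains f where "f \<in> carrier A" "f \<noteq> \<one>\<^bsub>A\<^esub>" "\<And>j. shift j f \<in> C"
proof -
  let ?F = "\<lambda>f. \<lambda>j\<in>{0..<int k}. C #>\<^bsub>A\<^esub> shift j f"
  have "?F ` carrier A \<subseteq> {0..<int k} \<rightarrow>\<^sub>E rcosets\<^bsub>A\<^esub> C"
    by (auto simp: rcosets_image)
  then have "finite (?F ` carrier A)"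
    using C(2) by (meson finite_PiE finite_atLeastLessThan_int finite_subset)
  then have "\<not> inj_on ?F (carrier A)"
    using infinite_A finite_imageD by blast
  then obtain x y where xy: "x \<in> carrier A" "y \<in> carrier A" "?F x = ?F y" "x \<noteq> y"
    by (auto simp: inj_on_def)
  define f where "f = x \<otimes>\<^bsub>A\<^esub> inv\<^bsub>A\<^esub> y"
  have "shift j f \<in> C" if "j \<in> {0..<int k}" for j
    using fun_cong[OF xy(3), of j] that xy(1,2) A.rcos_eq_iff[OF C(1), of "shift j x" "shift j y"]
    by (simp add: f_def shift_mult shift_inv)
  moreover have up: "shift (int k * int m) z \<in> C" if "z \<in> C" for z m
    using that
  proof (induction m)
    case (Suc m)
    then show ?case using inv(1)[of "shift (int k * int m) z"] by (simp add: algebra_simps)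
  qed simp
  moreover have dn: "shift (- (int k * int m)) z \<in> C" if "z \<in> C" for z m
    using that
  proof (induction m)
    case (Suc m)
    then show ?case using inv(2)[of "shift (- (int k * int m)) z"] by (simp add: algebra_simps)
  qed simp
  ultimately have "shift j f \<in> C" for j
  proof -
    have z: "shift (j mod int k) f \<in> C"
      using \<open>\<And>j. j \<in> {0..<int k} \<Longrightarrow> shift j f \<in> C\<close> k by simp
    have sh: "shift (int k * q) (shift (j mod int k) f) \<in> C" for q
      by (cases q rule: int_cases2) (use up[OF z] dn[OF z] in simp_all)
    show ?thesis using sh[of "j div int k"] by simp
  qed
  moreover have "f \<noteq> \<one>\<^bsub>A\<^esub>"
  proof
    assume "f = \<one>\<^bsub>A\<^esub>"
    then have "x = y" using xy A.inv_equality[of x "inv\<^bsub>A\<^esub> y"] by (simp add: f_def)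
    then show False using xy by simp
  qed
  moreover have "f \<in> carrier A" using xy by (simp add: f_def)
  ultimately show thesis using that by blast
qed

text \<open>This is the largest shift-invariant subgroup inside \<open>C\<close>; by
  \<open>conj_base\<close> conjugation acts on it by shifts.\<close>

lemma normal_of_shift_invariant:
  assumes C: "subgroup C A" 
  shows "{f \<in> carrier A. \<forall>j. shift j f \<in> C} \<times> {0} \<lhd> G"
proof (rule G.normal_invI)
  let ?N = "{f \<in> carrier A. \<forall>j. shift j f \<in> C} \<times> {0::int}"
  show "subgroup ?N G"
  proof
    show "?N \<subseteq> carrier G" by auto
    show "\<one>\<^bsub>G\<^esub> \<in> ?N" using subgroup.one_closed[OF C] by (simp add: one_G)
  next
    fix x y assume "x \<in> ?N" "y \<in> ?N"
    then show "x \<otimes>\<^bsub>G\<^esub> y \<in> ?N" using subgroup.m_closed[OF C] by (auto simp: shift_mult)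
  next
    fix x assume "x \<in> ?N"
    then show "inv\<^bsub>G\<^esub> x \<in> ?N" using subgroup.m_inv_closed[OF C] by (auto simp: inv_G shift_inv)
  qed
  fix g h assume "g \<in> carrier G" "h \<in> ?N"
  then show "g \<otimes>\<^bsub>G\<^esub> h \<otimes>\<^bsub>G\<^esub> inv\<^bsub>G\<^esub> g \<in> ?N"
    by (cases g) (auto simp: conj_base simp del: mult_G)
qed

text \<open>If a nontrivial element of \<open>N\<close> is not itself in the base group, its
  commutator with a suitable base element is nontrivial and lies there; conjugation then supplies
  all shifts.\<close>

lemma normal_meets_base:
  assumes N: "N \<lhd> G" "N \<noteq> {\<one>\<^bsub>G\<^esub>}"
  obtains f where "f \<in> carrier A" "f \<noteq> \<one>\<^bsub>A\<^esub>" "\<And>j. (shift j f, 0) \<in> N"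
proof -
  have sub: "subgroup N G" using N(1) by (rule normal_imp_subgroup)
  obtain b m where bm: "(b, m) \<in> N" "(b, m) \<noteq> \<one>\<^bsub>G\<^esub>"
    using N(2) subgroup.one_closed[OF sub] by auto
  have b: "b \<in> carrier A" using bm(1) subgroup.mem_carrier[OF sub] by auto
  have "\<exists>f. f \<in> carrier A \<and> f \<noteq> \<one>\<^bsub>A\<^esub> \<and> (f, 0) \<in> N"
  proof (cases "m = 0")
    case True
    then show ?thesis using bm b by (auto simp: one_G)
  next
    case False
    \<comment> \<open>The base element \<open>e\<close> is the unit vector at coordinate 0. Since
      \<open>m \<noteq> 0\<close>, its shift by \<open>m\<close> vanishes there.\<close>
    have "finite {q. (if q = (0::int) then 1 else 0::int) \<noteq> 0}" by simp
    moreover have "0 \<le> (if q = 0 then 1 else 0::int) \<and> (if q = 0 then 1 else 0) < int p" for q :: int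
      using p_gt_1 by simp
    ultimately obtain e where e: "e \<in> carrier A" "\<And>q. coord e q = (if q = 0 then 1 else 0)"
      by (rule coord_surj) (rule that)
    have "(e, 0) \<otimes>\<^bsub>G\<^esub> (b, m) \<otimes>\<^bsub>G\<^esub> inv\<^bsub>G\<^esub> (e, 0) \<in> N"
      using normal.inv_op_closed2[OF N(1), of "(e, 0)" "(b, m)"] bm(1) e(1) by simp
    then have "(e, 0) \<otimes>\<^bsub>G\<^esub> (b, m) \<otimes>\<^bsub>G\<^esub> inv\<^bsub>G\<^esub> (e, 0) \<otimes>\<^bsub>G\<^esub> inv\<^bsub>G\<^esub> (b, m) \<in> N"
      by (rule subgroup.m_closed[OF sub _ subgroup.m_inv_closed[OF sub bm(1)]])
    moreover have "(e, 0) \<otimes>\<^bsub>G\<^esub> (b, m) \<otimes>\<^bsub>G\<^esub> inv\<^bsub>G\<^esub> (e, 0) \<otimes>\<^bsub>G\<^esub> inv\<^bsub>G\<^esub> (b, m) = (e \<otimes>\<^bsub>A\<^esub> inv\<^bsub>A\<^esub> (shift m e), 0)"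
    proof -
      have "(e, 0) \<otimes>\<^bsub>G\<^esub> (b, m) \<otimes>\<^bsub>G\<^esub> inv\<^bsub>G\<^esub> (e, 0) = (e \<otimes>\<^bsub>A\<^esub> inv\<^bsub>A\<^esub> (shift m e) \<otimes>\<^bsub>A\<^esub> b, m)"
        using e(1) b by (simp add: inv_G shift_inv A.m_ac)
      then show ?thesis using e(1) b by (simp add: div_G A.m_assoc)
    qed
    moreover have "e \<otimes>\<^bsub>A\<^esub> inv\<^bsub>A\<^esub> (shift m e) \<noteq> \<one>\<^bsub>A\<^esub>"
    proof
      assume "e \<otimes>\<^bsub>A\<^esub> inv\<^bsub>A\<^esub> (shift m e) = \<one>\<^bsub>A\<^esub>"
      then have "coord (e \<otimes>\<^bsub>A\<^esub> inv\<^bsub>A\<^esub> (shift m e)) 0 = 0" by simp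
      then show False using e False n_pos p_gt_1 by (simp add: coord_mult coord_inv coord_shift)
    qed
    ultimately show ?thesis using e(1) by (intro exI[of _ "e \<otimes>\<^bsub>A\<^esub> inv\<^bsub>A\<^esub> (shift m e)"]) simp
  qed
  then obtain f where f: "f \<in> carrier A" "f \<noteq> \<one>\<^bsub>A\<^esub>" "(f, 0) \<in> N" by blast
  have "(shift j f, 0) \<in> N" for j
    using normal.inv_op_closed2[OF N(1), of "(\<one>\<^bsub>A\<^esub>, j)" "(f, 0)"] f by (simp add: conj_base del: mult_G)
  then show thesis using that f by blast
qed

text \<open>For \<open>n = 1\<close> this says that the ideal of a nonzero Laurent polynomial over a finite field has
  finite index: cancelling the extreme coordinates by shifts of \<open>f\<close> leaves a representative
  supported on a fixed interval.\<close>

lemma finite_index_bound: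
  assumes n: "n = 1" and f: "f \<in> carrier A" "f \<noteq> \<one>\<^bsub>A\<^esub>"
  obtains c where "\<And>C. subgroup C A \<Longrightarrow> (\<And>j. shift j f \<in> C) \<Longrightarrow> card (rcosets\<^bsub>A\<^esub> C) \<le> c"
proof -
  have ne: "supp f \<noteq> {}" using supp_empty f by blast
  have fin: "finite (supp f)" by (rule finite_supp[OF f(1)])
  define t where "t = Max (supp f)"
  define l where "l = Min (supp f)"
  have t: "coord f t \<noteq> 0" and l: "coord f l \<noteq> 0" 
    using Max_in[OF fin ne] Min_in[OF fin ne] by (auto simp: t_def l_def supp_def)
  have sf: "supp f \<subseteq> {l..t}" using fin by (auto simp: t_def l_def)
  define V where "V = {v \<in> carrier A. supp v \<subseteq> {l..<t}}"
  have V: "finite V" by (simp add: V_def card_supported)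
  \<comment> \<open>\<open>V\<close> depends on \<open>f\<close> alone, so the bound is uniform in
    \<open>C\<close>.\<close>
  have "card (rcosets\<^bsub>A\<^esub> C) \<le> card V" if C: "subgroup C A" "\<And>j. shift j f \<in> C" for C
  proof -
    have fm: "shift j f [^]\<^bsub>A\<^esub> (m::nat) \<in> C" for j m
      using C by (metis A.subgroup_int_pow_closed int_pow_int)
    have cs: "coord (shift j x) q = coord x (q - j)" for j x q
      unfolding coord_shift using n by simp
    have sfs: "supp (shift j f) \<subseteq> {l + j..t + j}" for j
    proof
      fix q assume "q \<in> supp (shift j f)"
      then have "q - j \<in> supp f" by (simp add: supp_def cs)
      then show "q \<in> {l + j..t + j}" using sf by auto
    qed
    \<comment> \<open>Each induction step trims one place at either end, until the interval has one
      place fewer than \<open>{l..t}\<close>.\<close>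
    have red: "\<exists>v\<in>V. C #>\<^bsub>A\<^esub> x = C #>\<^bsub>A\<^esub> v" if "x \<in> carrier A" "supp x \<subseteq> {l - int m..<t + int m}" for x m
      using that
    proof (induction m arbitrary: x)
      case 0
      then show ?case by (auto simp: V_def)
    next
      case (Suc m)
      have abs: "C #>\<^bsub>A\<^esub> (z \<otimes>\<^bsub>A\<^esub> shift j f [^]\<^bsub>A\<^esub> (i::nat)) = C #>\<^bsub>A\<^esub> z" if "z \<in> carrier A" for z i j
      proof -
        have "z \<otimes>\<^bsub>A\<^esub> shift j f [^]\<^bsub>A\<^esub> i \<otimes>\<^bsub>A\<^esub> inv\<^bsub>A\<^esub> z = shift j f [^]\<^bsub>A\<^esub> i"
          using that f(1) by (simp add: A.m_assoc A.m_lcomm[of z])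
        then show ?thesis using fm[of j i] that f(1) by (simp add: A.rcos_eq_iff[OF C(1)])
      qed
      let ?h = "shift (int m) f"
      have "coord ?h (t + int m) \<noteq> 0" using t by (simp add: cs)
      then obtain i :: nat where i: "coord (x \<otimes>\<^bsub>A\<^esub> ?h [^]\<^bsub>A\<^esub> i) (t + int m) = 0"
        using cancel_coord[of x ?h "t + int m"] Suc.prems f(1) by auto
      define y where "y = x \<otimes>\<^bsub>A\<^esub> ?h [^]\<^bsub>A\<^esub> i"
      have yc: "y \<in> carrier A" using Suc.prems f(1) by (simp add: y_def)
      have ys: "supp y \<subseteq> {l - int (Suc m)..<t + int m}"
      proof
        fix q assume q: "q \<in> supp y"
        then have "q \<noteq> t + int m" using i by (auto simp: supp_def y_def)
        moreover have "q \<in> supp x \<union> supp ?h"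
          using q supp_mult[of x "?h [^]\<^bsub>A\<^esub> i"] supp_pow[of ?h i] f(1) by (auto simp: y_def)
        ultimately show "q \<in> {l - int (Suc m)..<t + int m}"
          using Suc.prems(2) sfs[of "int m"] by auto
      qed
      \<comment> \<open>The top of this shift is \<open>t - int (Suc m)\<close>, below
        \<open>t + int m\<close>, so the coordinate just cleared remains zero.\<close>
      let ?g = "shift (- int (Suc m)) f"
      have "coord ?g (l - int (Suc m)) \<noteq> 0" using l by (simp add: cs)
      then obtain j :: nat where j: "coord (y \<otimes>\<^bsub>A\<^esub> ?g [^]\<^bsub>A\<^esub> j) (l - int (Suc m)) = 0"
        using cancel_coord[of y ?g "l - int (Suc m)"] yc f(1) by auto
      define z where "z = y \<otimes>\<^bsub>A\<^esub> ?g [^]\<^bsub>A\<^esub> j"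
      have zc: "z \<in> carrier A" using yc f(1) by (simp add: z_def)
      have zs: "supp z \<subseteq> {l - int m..<t + int m}"
      proof
        fix q assume q: "q \<in> supp z"
        then have "q \<noteq> l - int (Suc m)" using j by (auto simp: supp_def z_def)
        moreover have "q \<in> supp y \<union> supp ?g"
          using q supp_mult[of y "?g [^]\<^bsub>A\<^esub> j"] supp_pow[of ?g j] f(1) by (auto simp: z_def)
        ultimately show "q \<in> {l - int m..<t + int m}"
          using ys sfs[of "- int (Suc m)"] by auto
      qed
      obtain v where "v \<in> V" "C #>\<^bsub>A\<^esub> z = C #>\<^bsub>A\<^esub> v" using Suc.IH[OF zc zs] by blast
      moreover have "C #>\<^bsub>A\<^esub> z = C #>\<^bsub>A\<^esub> x"
        using abs[OF yc] abs[OF Suc.prems(1)] by (simp add: z_def y_def)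
      ultimately show ?case by auto
    qed
    have "rcosets\<^bsub>A\<^esub> C \<subseteq> (\<lambda>v. C #>\<^bsub>A\<^esub> v) ` V"
    proof
      fix D assume "D \<in> rcosets\<^bsub>A\<^esub> C"
      then obtain x where x: "x \<in> carrier A" "D = C #>\<^bsub>A\<^esub> x" by (auto simp: rcosets_image)
      obtain b where b: "supp x \<subseteq> {-b..<b}"
        using finite_int_bounds[OF finite_supp[OF x(1)]] by blast
      define m where "m = nat (\<bar>b\<bar> + \<bar>l\<bar> + \<bar>t\<bar>)"
      have "supp x \<subseteq> {l - int m..<t + int m}" 
      proof (rule subset_trans[OF b])
        show "{-b..<b} \<subseteq> {l - int m..<t + int m}" by (auto simp: m_def)
      qed
      then show "D \<in> (\<lambda>v. C #>\<^bsub>A\<^esub> v) ` V" using red[OF x(1)] x(2) by blast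
    qed
    then show ?thesis using V by (meson card_image_le card_mono finite_imageI le_trans)
  qed
  then show thesis using that by blast
qed

section \<open>Rank gradients\<close>

lemma chainD:
  assumes "descending_finite_index_chain G H" "i \<ge> 1"
  shows "subgroup (H i) G" "finite (rcosets\<^bsub>G\<^esub> (H i))" "j \<ge> i \<Longrightarrow> H j \<subseteq> H i"
proof -
  show "subgroup (H i) G" "finite (rcosets\<^bsub>G\<^esub> (H i))"
    using assms by (auto simp: descending_finite_index_chain_def)
  show "j \<ge> i \<Longrightarrow> H j \<subseteq> H i"
  proof (induction j rule: dec_induct)
    case (step m)
    then have "H (Suc m) \<subseteq> H m"
      using assms by (simp add: descending_finite_index_chain_def)
    then show ?case using step by blast
  qed simp
qed

lemma has_rank_gradient_iff:
  assumes "descending_finite_index_chain G H"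
  shows "has_rank_gradient G H 0 \<longleftrightarrow>
    (\<lambda>i. real n / real (card (rcosets\<^bsub>A\<^esub> (base_part (H i))))) \<longlonglongrightarrow> 0"
proof -
  let ?c = "\<lambda>i. real n / real (card (rcosets\<^bsub>A\<^esub> (base_part (H i))))"
  \<comment> \<open>Chains start at index 1 and \<open>H 0\<close> is arbitrary, so the equality is
    only claimed eventually.\<close>
  have "\<forall>\<^sub>F i in sequentially.
      (ereal_of_enat (min_generators G (H i)) - 1) / ereal (real (subgroup_index G (H i))) = ereal (?c i)"
    using eventually_ge_at_top[of 1]
  proof eventually_elim
    case (elim i)
    show ?case by (rule rank_ratio(1)[OF chainD(1,2)[OF assms elim]])
  qed
  then have "has_rank_gradient G H 0 \<longleftrightarrow> (\<lambda>i. ereal (?c i)) \<longlonglongrightarrow> ereal 0"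
    unfolding has_rank_gradient_def zero_ereal_def[symmetric] by (rule filterlim_cong[OF refl refl])
  then show ?thesis by (simp only: lim_ereal)
qed

lemma rank_gradient_zero:
  assumes ch: "descending_finite_index_chain G H" and core: "has_trivial_core G H"
  shows "has_rank_gradient G H 0"
proof -
  define B where "B i = base_part (H i)" for i
  define c where "c i = card (rcosets\<^bsub>A\<^esub> (B i))" for i
  have B: "subgroup (B i) A" "finite (rcosets\<^bsub>A\<^esub> (B i))" if "i \<ge> 1" for i
    using rank_ratio(2)[OF chainD(1,2)[OF ch that]] subgroup_base_part[OF chainD(1)[OF ch that]]
    by (simp_all add: B_def)
  have BB: "B j \<subseteq> B i" if "i \<ge> 1" "j \<ge> i" for i j
    using chainD(3)[OF ch that] by (auto simp: B_def)
  have mono: "c i \<le> c j" "c i = c j \<Longrightarrow> B i = B j" if "i \<ge> 1" "j \<ge> i" for i j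
    using A.finite_rcosets_mono[OF B(1) B(1) BB[OF that] B(2)] that by (auto simp: c_def)
  have unbounded: "\<exists>i\<ge>1. c i \<ge> z" for z
  proof (rule ccontr)
    assume "\<not> (\<exists>i\<ge>1. c i \<ge> z)"
    then have bd: "c i < z" if "i \<ge> 1" for i using that by auto
    have fin: "finite (c ` {1..})" by (rule finite_subset[of _ "{..<z}"]) (use bd in auto)
    have "Max (c ` {1..}) \<in> c ` {1..}" using fin by (intro Max_in) auto
    then obtain i where i: "i \<ge> 1" "c i = Max (c ` {1..})" by auto
    have le: "c j \<le> c i" if "j \<ge> 1" for j using that fin i(2) by simp
    \<comment> \<open>After \<open>i\<close> the maximal index cannot grow, so the base parts equal
      \<open>B i\<close>; before \<open>i\<close> the chain descends.\<close>
    have sub: "B i \<subseteq> B j" if j: "j \<ge> 1" for j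
    proof (cases "j \<ge> i")
      case True
      then have "c i = c j" using mono(1)[OF i(1) True] le[OF j] by simp
      then show ?thesis using mono(2)[OF i(1) True] by simp
    qed (use BB[OF j, of i] in auto)
    obtain k where k: "k > 0" "\<forall>x\<in>B i. shift (int k) x \<in> B i \<and> shift (- int k) x \<in> B i"
      using rank_ratio(3)[OF chainD(1,2)[OF ch i(1)]] by (auto simp: B_def simp del: mem_base_part)
    obtain f where f: "f \<in> carrier A" "f \<noteq> \<one>\<^bsub>A\<^esub>" "\<And>j. shift j f \<in> B i"
      using shift_invariant_core_nontrivial[OF B[OF i(1)] k(1)] k(2) by blast
    \<comment> \<open>Normal in \<open>G\<close>, inside every \<open>H j\<close> because the base
      parts stabilise, and nontrivial because of \<open>f\<close>.\<close>
    let ?N = "{f \<in> carrier A. \<forall>j. shift j f \<in> B i} \<times> {0::int}"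
    have "?N \<lhd> G" by (rule normal_of_shift_invariant[OF B(1)[OF i(1)]])
    moreover have "?N \<subseteq> (\<Inter>j\<in>{1..}. H j)"
    proof clarify
      fix g and j :: nat assume g: "g \<in> carrier A" "\<forall>j. shift j g \<in> B i" "1 \<le> j"
      then have "shift 0 g \<in> B i" by blast
      then show "(g, 0) \<in> H j" using sub[of j] g(3) by (auto simp: B_def)
    qed
    ultimately have "?N = {\<one>\<^bsub>G\<^esub>}" using core unfolding has_trivial_core_def by blast
    moreover have "(f, 0) \<in> ?N" using f by simp
    ultimately show False using f(2) by (simp add: one_G)
  qed
  have "filterlim (\<lambda>i. real (c i)) at_top sequentially"
    unfolding filterlim_at_top
  proof
    fix z :: real
    obtain i where i: "i \<ge> 1" "c i \<ge> nat \<lceil>z\<rceil>" using unbounded by blast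
    then have "z \<le> real (c j)" if "j \<ge> i" for j
      using mono(1)[OF i(1) that] by linarith
    then show "\<forall>\<^sub>F j in sequentially. z \<le> real (c j)"
      unfolding eventually_sequentially by blast
  qed
  then have "(\<lambda>i. real n / real (c i)) \<longlonglongrightarrow> 0"
    by (rule real_tendsto_divide_at_top[OF tendsto_const])
  then show ?thesis unfolding has_rank_gradient_iff[OF ch] c_def B_def .
qed

text \<open>A nontrivial normal subgroup in the core provides one \<open>f\<close> whose shifts lie
  in all base parts. The resulting bound \<open>c\<close> on their indices is the same for every
  \<open>i\<close> and keeps the ratios at least \<open>1 / c\<close>.\<close>

lemma trivial_core:
  assumes n: "n = 1" and ch: "descending_finite_index_chain G H" and rg: "has_rank_gradient G H 0"
  shows "has_trivial_core G H"
  unfolding has_trivial_core_def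
proof (intro allI impI, rule ccontr)
  fix N assume N: "N \<lhd> G \<and> N \<subseteq> (\<Inter>i\<in>{1..}. H i)" "N \<noteq> {\<one>\<^bsub>G\<^esub>}"
  then obtain f where f: "f \<in> carrier A" "f \<noteq> \<one>\<^bsub>A\<^esub>" "\<And>j. (shift j f, 0) \<in> N"
    using normal_meets_base by blast
  obtain c where c: "\<And>C. subgroup C A \<Longrightarrow> (\<And>j. shift j f \<in> C) \<Longrightarrow> card (rcosets\<^bsub>A\<^esub> C) \<le> c"
    using finite_index_bound[OF n f(1,2)] by blast
  let ?m = "\<lambda>i. card (rcosets\<^bsub>A\<^esub> (base_part (H i)))"
  have bd: "?m i \<le> c \<and> ?m i > 0" if i: "i \<ge> 1" for i
  proof
    show "?m i \<le> c"
      using f(3) N(1) i by (intro c subgroup_base_part[OF chainD(1)[OF ch i]]) auto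
    show "?m i > 0" by (rule card_rcosets_pos[OF rank_ratio(2)[OF chainD(1,2)[OF ch i]]])
  qed
  have c_pos: "c > 0" using bd[of 1] by simp
  have "(\<lambda>i. real n / real (?m i)) \<longlonglongrightarrow> 0"
    using rg has_rank_gradient_iff[OF ch] by blast
  moreover have "1 / real c > 0" using c_pos by simp
  ultimately have "\<forall>\<^sub>F i in sequentially. real n / real (?m i) < 1 / real c"
    by (rule order_tendstoD(2))
  then obtain i0 where i0: "\<And>i. i \<ge> i0 \<Longrightarrow> real n / real (?m i) < 1 / real c"
    unfolding eventually_sequentially by blast
  \<comment> \<open>The successor ensures an index of at least 1, where the chain conditions
    hold.\<close>
  have "1 / real (?m (Suc i0)) < 1 / real c" using i0[of "Suc i0"] n by simp
  moreover have "1 / real c \<le> 1 / real (?m (Suc i0))"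
    using bd[of "Suc i0"] by (intro divide_left_mono) auto
  ultimately show False by simp
qed

end

theorem theorem4p1:
  fixes p n :: nat
  assumes "Factorial_Ring.prime p" and "n \<ge> 1"
  shows "(\<forall>H. descending_finite_index_chain (lamplighter p n) H \<and>
              has_trivial_core (lamplighter p n) H \<longrightarrow>
              has_rank_gradient (lamplighter p n) H 0) \<and>
         (n = 1 \<longrightarrow>
           (\<forall>H. descending_finite_index_chain (lamplighter p 1) H \<and>
                has_rank_gradient (lamplighter p 1) H 0 \<longrightarrow>
                has_trivial_core (lamplighter p 1) H))"
proof -
  interpret lamp p n by unfold_locales (use assms in auto)
  show ?thesis using rank_gradient_zero trivial_core by auto
qed

end
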